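(* Let $d\ge 3$, $p\in[0,1]$, and let $S=(S_n)_{n\ge 0}$ be a multi-dimensional elephant random walk on $\mathbb{Z}^d$ with memory parameter $p$. Then $S$ is transient. More precisely, for every $\nu\in\left(0,\frac12-\frac1d\right)$, $$\mathbb{E}\left(\sum_{n=1}^{\infty}\mathbf 1_{\{\|S_n\|\le n^{\nu}\}}\right)<\infty ;$$ in particular, almost surely, $\|S_n\|>n^{\nu}$ for all sufficiently large $n$.
   Context: Multi-dimensional elephant random walk (MERW): let $e_1,\dots,e_d$ be the standard basis of $\mathbb{R}^d$ and $p\in[0,1]$. Set $S_0=0$ and $S_1=\sigma_1=e_1$. For each $n\ge 1$, choose $n'$ uniformly at random in $\{1,\dots,n\}$ (independently of the past); given the past and $n'$, let $\sigma_{n+1}=\sigma_{n'}$ with probability $p$, and $\sigma_{n+1}=\sigma$ with probability $\frac{1-p}{2d-1}$ for each $\sigma\in\{\pm e_1,\dots,\pm e_d\}\setminus\{\sigma_{n'}\}$. Set $S_{n+1}=S_n+\sigma_{n+1}$. The process $(S_n)_{n\ge0}$ is a MERW on $\mathbb{Z}^d$ with memory parameter $p$. $\|\cdot\|$ is the Euclidean norm. A random walk $(S_n)$ on $\mathbb{Z}^d$ is called transient if for every $x\in\mathbb{Z}^d$, $\mathbb{P}(S_n=x\text{ for only finitely many }n)=1$. *)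

theory Defs
  imports "HOL-Probability.Probability"
begin

definition unit_steps :: "(real ^ 'd) set" where
  "unit_steps = (\<Union>i. {axis i 1, - axis i 1})"

definition integer_lattice :: "(real ^ 'd) set" where
  "integer_lattice = {x. \<forall>i. x $ i \<in> \<int>}"

text \<open>
  The index type \<open>'d\<close> carries no order, so the coordinate playing the role of the first one is a
  parameter \<open>i\<^sub>1\<close>. The variable \<open>mem n\<close> is the time \<open>n'\<close> remembered when the step
  \<open>\<sigma> (Suc n)\<close> is drawn. The past at time \<open>n\<close> is the history \<open>\<sigma> 1, \<dots>, \<sigma> n\<close> of the walk. Since all
  the variables involved are discrete, conditioning on the past and on \<open>mem n\<close> is elementary
  conditioning on the events of positive probability that fix their values.
  \<open>\<sigma> 0\<close> and \<open>mem 0\<close> are irrelevant. Independence is stated through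
  the generated \<open>\<sigma>\<close>-algebras, as \<open>indep_var\<close> wants both variables to have values in one type.
\<close>

locale merw = prob_space M for M :: "'a measure" +
  fixes p :: real
    and i\<^sub>1 :: "'d :: finite"
    and mem :: "nat \<Rightarrow> 'a \<Rightarrow> nat"
    and \<sigma> :: "nat \<Rightarrow> 'a \<Rightarrow> real ^ 'd"
    and S :: "nat \<Rightarrow> 'a \<Rightarrow> real ^ 'd"
  assumes random_variable_step: "\<And>n. n \<ge> 1 \<Longrightarrow> random_variable borel (\<sigma> n)"
    and position_0: "\<And>\<omega>. \<omega> \<in> space M \<Longrightarrow> S 0 \<omega> = 0"
    and position_Suc: "\<And>n \<omega>. \<omega> \<in> space M \<Longrightarrow> S (Suc n) \<omega> = S n \<omega> + \<sigma> (Suc n) \<omega>"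
    and first_step: "\<And>\<omega>. \<omega> \<in> space M \<Longrightarrow> \<sigma> 1 \<omega> = axis i\<^sub>1 1"
    and mem_uniform: "\<And>n. n \<ge> 1 \<Longrightarrow>
          distr M (count_space UNIV) (mem n) = measure_pmf (pmf_of_set {1..n})"
    and mem_indep_past: "\<And>n. n \<ge> 1 \<Longrightarrow>
          indep_set
            (sets (vimage_algebra (space M) (\<lambda>\<omega>. \<lambda>i\<in>{1..n}. \<sigma> i \<omega>) (PiM {1..n} (\<lambda>_. borel))))
            (sets (vimage_algebra (space M) (mem n) (count_space UNIV)))"
    and step_repeat: "\<And>n k h. \<lbrakk>n \<ge> 1; k \<in> {1..n};
          \<P>(\<omega> in M. (\<forall>i\<in>{1..n}. \<sigma> i \<omega> = h i) \<and> mem n \<omega> = k) > 0\<rbrakk> \<Longrightarrow>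
          \<P>(\<omega> in M. \<sigma> (Suc n) \<omega> = h k \<bar> (\<forall>i\<in>{1..n}. \<sigma> i \<omega> = h i) \<and> mem n \<omega> = k) = p"
    and step_change: "\<And>n k h v. \<lbrakk>n \<ge> 1; k \<in> {1..n}; v \<in> unit_steps - {h k};
          \<P>(\<omega> in M. (\<forall>i\<in>{1..n}. \<sigma> i \<omega> = h i) \<and> mem n \<omega> = k) > 0\<rbrakk> \<Longrightarrow>
          \<P>(\<omega> in M. \<sigma> (Suc n) \<omega> = v \<bar> (\<forall>i\<in>{1..n}. \<sigma> i \<omega> = h i) \<and> mem n \<omega> = k)
            = (1 - p) / (2 * real CARD('d) - 1)"

definition transient_walk :: "'a measure \<Rightarrow> (nat \<Rightarrow> 'a \<Rightarrow> real ^ 'd) \<Rightarrow> bool" where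
  "transient_walk M S \<longleftrightarrow>
     (\<forall>x\<in>integer_lattice. \<P>(\<omega> in M. finite {n. S n \<omega> = x}) = 1)"

end

theory Submission
  imports Defs "HOL-Real_Asymp.Real_Asymp"
begin

text \<open>
  Write \<open>d\<close> for the dimension, \<open>q\<close> for the probability \<open>(1 - p) / (2 d - 1)\<close> of each particular
  change, and let \<open>w u v\<close> be \<open>p\<close> if \<open>u = v\<close> and \<open>q\<close> otherwise. The theorem follows from a local
  bound: for \<open>p < 1\<close>, the walk is at a given lattice point at time \<open>N\<close> with probability at most \<open>(C / \<surd>N)\<^sup>d\<close>, uniformly
  in the point. A ball of radius \<open>N powr \<nu>\<close> contains \<open>O(N powr (\<nu> d))\<close> lattice points, so the walk
  is in it with probability \<open>O(N powr ((\<nu> - 1/2) d))\<close>. The exponent is below \<open>-1\<close> exactly when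
  \<open>\<nu> < 1/2 - 1/d\<close>. Then the expected number of visits is finite, the first Borel-Cantelli lemma gives
  \<open>\<parallel>S\<^sub>N\<parallel> > N powr \<nu>\<close> eventually, and transience follows. For \<open>p = 1\<close> the walk is almost surely
  \<open>S\<^sub>N = N e\<^sub>1\<close> and the probabilities in question vanish for large \<open>N\<close>.

  For the local bound, the history \<open>\<sigma> 1, \<dots>, \<sigma> N\<close> equals \<open>h\<close> with probability
  \<open>\<Prod>m = 2..N. (\<Sum>k<m. w (h k) (h m)) / (m - 1)\<close>. Expanding the product shows that this is the average,
  over all recursive trees \<open>f\<close> (each vertex \<open>m \<ge> 2\<close> has a parent \<open>f m < m\<close>), of the law of a Markov
  chain indexed by \<open>f\<close> with transition weights \<open>w\<close>. The expansion concerns the law of the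
  history only, since the hypotheses leave the joint law of the remembered times open. Given the
  tree and the steps at its inner vertices, the steps at the leaves are independent, and the
  characteristic function of each of them has norm at most \<open>\<rho>(t) = 1 - (q / (3 d)) \<Sum>j. sin\<^sup>2 t\<^sub>j\<close>
  (lemma \<open>norm_step_char_le\<close>). Hence the characteristic function of \<open>S\<^sub>N\<close> has norm at most the mean
  of \<open>\<rho>(t) ^ L\<close>, where \<open>L\<close> is the number of leaves of a random recursive tree. Since \<open>L\<close> has mean
  \<open>N / 2\<close>, an association argument bounds this mean by \<open>((1 + \<rho>(t)) / 2) ^ (N - 2)\<close>
  (lemma \<open>sum_power_card_leaves_le\<close>), which is of the quality that independent steps would give.
  Discrete Fourier inversion then yields the local bound (lemma \<open>endpoint_probability_le\<close>).
\<close>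

section \<open>Sums over families of functions\<close>

lemma sum_PiE_Un:
  assumes "Q \<inter> L = {}"
  shows "(\<Sum>h\<in>PiE (Q \<union> L) B. F h) = (\<Sum>a\<in>PiE Q B. \<Sum>b\<in>PiE L B. F (merge Q L (a, b)))"
proof -
  have merge_restrict: "merge Q L (restrict h Q, restrict h L) = h" if "h \<in> PiE (Q \<union> L) B" for h
    using that by (auto simp: merge_def PiE_def extensional_def fun_eq_iff)
  have "(\<Sum>h\<in>PiE (Q \<union> L) B. F h) = (\<Sum>(a, b)\<in>PiE Q B \<times> PiE L B. F (merge Q L (a, b)))"
    by (rule sum.reindex_bij_witness[where i = "merge Q L" and j = "\<lambda>h. (restrict h Q, restrict h L)"])
       (use assms in \<open>auto simp: merge_restrict[simplified] merge_restrict\<close>)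
  then show ?thesis
    by (simp add: sum.cartesian_product)
qed

text \<open>
  Chebyshev's association inequality: oppositely ordered families are negatively correlated under
  the uniform distribution, since twice the defect is a double sum of the given products.
\<close>

lemma sum_mult_le_of_opposite_order:
  fixes a b :: "'i \<Rightarrow> real"
  assumes "\<And>i j. i \<in> I \<Longrightarrow> j \<in> I \<Longrightarrow> (a i - a j) * (b i - b j) \<le> 0"
  shows "real (card I) * (\<Sum>i\<in>I. a i * b i) \<le> (\<Sum>i\<in>I. a i) * (\<Sum>i\<in>I. b i)"
proof -
  have "(\<Sum>i\<in>I. \<Sum>j\<in>I. (a i - a j) * (b i - b j))
      = (\<Sum>i\<in>I. \<Sum>j\<in>I. a i * b i) - (\<Sum>i\<in>I. \<Sum>j\<in>I. a i * b j)
        - (\<Sum>j\<in>I. \<Sum>i\<in>I. a i * b j) + (\<Sum>j\<in>I. \<Sum>i\<in>I. a i * b i)"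
    by (simp add: algebra_simps sum.distrib sum_subtractf)
  also have "\<dots> = 2 * (real (card I) * (\<Sum>i\<in>I. a i * b i) - (\<Sum>i\<in>I. a i) * (\<Sum>i\<in>I. b i))"
    unfolding sum.swap[of "\<lambda>j i. a i * b j"] by (simp add: sum_product flip: sum_distrib_left)
  finally have "2 * (real (card I) * (\<Sum>i\<in>I. a i * b i) - (\<Sum>i\<in>I. a i) * (\<Sum>i\<in>I. b i))
      = (\<Sum>i\<in>I. \<Sum>j\<in>I. (a i - a j) * (b i - b j))" ..
  also have "\<dots> \<le> 0"
    by (intro sum_nonpos assms)
  finally show ?thesis by simp
qed

section \<open>Leaves of random recursive trees\<close>

text \<open>
  Vertex \<open>m \<ge> 2\<close> has the parent \<open>f m < m\<close>, so that a uniform element of this set is a random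
  recursive tree. The functions are extensional to make the set finite.
\<close>

definition recursive_trees :: "nat \<Rightarrow> (nat \<Rightarrow> nat) set" where
  "recursive_trees N = (\<Pi>\<^sub>E m\<in>{2..N}. {1..<m})"

definition leaves :: "nat \<Rightarrow> (nat \<Rightarrow> nat) \<Rightarrow> nat set" where
  "leaves N f = {1..N} - f ` {2..N}"

lemma finite_recursive_trees: "finite (recursive_trees N)"
  unfolding recursive_trees_def by (intro finite_PiE) auto

lemma card_recursive_trees: "real (card (recursive_trees N)) = (\<Prod>m\<in>{2..N}. real (m - 1))"
  unfolding recursive_trees_def by (simp add: card_PiE)

lemma card_recursive_trees_pos: "real (card (recursive_trees N)) > 0"
  unfolding card_recursive_trees by (intro prod_pos) auto

lemma recursive_trees_2: "recursive_trees 2 = {(\<lambda>_. undefined)(2 := 1)}"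
proof -
  have "{1..<2::nat} = {1}" "{2..2::nat} = insert 2 {}" by auto
  then show ?thesis
    unfolding recursive_trees_def by (simp only: PiE_insert_eq PiE_empty_domain) simp
qed

lemma sum_recursive_trees_Suc:
  fixes F :: "(nat \<Rightarrow> nat) \<Rightarrow> real"
  assumes "N \<ge> 1"
  shows "(\<Sum>f\<in>recursive_trees (Suc N). F f) = (\<Sum>f\<in>recursive_trees N. \<Sum>k\<in>{1..N}. F (f(Suc N := k)))"
proof -
  have eq: "{2..Suc N} = insert (Suc N) {2..N}" using assms by auto
  have inj: "inj_on (\<lambda>(k, f). f(Suc N := k)) ({1..<Suc N} \<times> recursive_trees N)"
  proof (rule inj_onI, clarify)
    fix k f k' f'
    assume f: "f \<in> recursive_trees N" "f' \<in> recursive_trees N" and e: "f(Suc N := k) = f'(Suc N := k')"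
    have "f m = f' m" for m
      using fun_cong[OF e, of m] f by (cases "m = Suc N") (auto simp: recursive_trees_def PiE_def extensional_def)
    then show "k = k' \<and> f = f'"
      using fun_cong[OF e, of "Suc N"] by auto
  qed
  have "recursive_trees (Suc N) = (\<lambda>(k, f). f(Suc N := k)) ` ({1..<Suc N} \<times> recursive_trees N)"
    unfolding recursive_trees_def eq by (subst PiE_insert_eq) simp
  then have "(\<Sum>f\<in>recursive_trees (Suc N). F f)
      = (\<Sum>(k, f)\<in>{1..<Suc N} \<times> recursive_trees N. F (f(Suc N := k)))"
    using sum.reindex[OF inj, of F] by (simp only: comp_def case_prod_unfold)
  also have "\<dots> = (\<Sum>k\<in>{1..<Suc N}. \<Sum>f\<in>recursive_trees N. F (f(Suc N := k)))"
    by (rule sum.cartesian_product[symmetric])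
  also have "\<dots> = (\<Sum>f\<in>recursive_trees N. \<Sum>k\<in>{1..N}. F (f(Suc N := k)))"
    by (subst sum.swap) (simp add: atLeastLessThanSuc_atLeastAtMost)
  finally show ?thesis .
qed

lemma leaves_Suc:
  assumes "f \<in> recursive_trees N" "N \<ge> 1" "k \<in> {1..N}"
  shows "leaves (Suc N) (f(Suc N := k)) = insert (Suc N) (leaves N f - {k})"
proof -
  have eq: "{2..Suc N} = insert (Suc N) {2..N}" "{1..Suc N} = insert (Suc N) {1..N}"
    using assms by auto
  have "f(Suc N := k) ` {2..N} = f ` {2..N}" by (intro image_cong) auto
  moreover have "Suc N \<notin> f ` {2..N}"
    using assms(1) by (force simp: recursive_trees_def PiE_def Pi_def)
  ultimately show ?thesis
    unfolding leaves_def eq using assms(2,3) by auto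
qed

lemma card_leaves_le: "card (leaves N f) \<le> N"
  unfolding leaves_def by (metis card_atLeastAtMost card_mono diff_Suc_1 Diff_subset finite_atLeastAtMost)

lemma finite_leaves: "finite (leaves N f)"
  unfolding leaves_def by simp

text \<open>
  A new vertex is always a leaf, and it destroys an old leaf exactly when it is attached to one.
  Hence the number of leaves stays the same for as many parents as there are leaves and grows by
  one for the others.
\<close>

lemma sum_recursive_trees_Suc_card_leaves:
  fixes F :: "nat \<Rightarrow> real"
  assumes "N \<ge> 1"
  shows "(\<Sum>f\<in>recursive_trees (Suc N). F (card (leaves (Suc N) f)))
    = (\<Sum>f\<in>recursive_trees N. real (card (leaves N f)) * F (card (leaves N f))
         + (real N - real (card (leaves N f))) * F (Suc (card (leaves N f))))"
  unfolding sum_recursive_trees_Suc[OF assms]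
proof (intro sum.cong refl)
  fix f assume f: "f \<in> recursive_trees N"
  have L: "leaves N f \<subseteq> {1..N}" by (auto simp: leaves_def)
  have new: "Suc N \<notin> leaves N f" by (auto simp: leaves_def)
  have card: "card (leaves (Suc N) (f(Suc N := k)))
      = (if k \<in> leaves N f then card (leaves N f) else Suc (card (leaves N f)))"
    if "k \<in> {1..N}" for k
    using that assms f new finite_leaves[of N f] card_gt_0_iff[of "leaves N f"]
    by (auto simp: leaves_Suc card_insert_if)
  have "(\<Sum>k\<in>{1..N}. F (card (leaves (Suc N) (f(Suc N := k)))))
      = (\<Sum>k\<in>{1..N}. if k \<in> leaves N f then F (card (leaves N f)) else F (Suc (card (leaves N f))))"
    using card by (intro sum.cong) auto
  also have "\<dots> = (\<Sum>k\<in>leaves N f. F (card (leaves N f)))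
      + (\<Sum>k\<in>{1..N} - leaves N f. F (Suc (card (leaves N f))))"
    using L by (subst sum.If_cases) (auto simp: Int_absorb1 Int_absorb2 Diff_eq)
  also have "\<dots> = real (card (leaves N f)) * F (card (leaves N f))
         + (real N - real (card (leaves N f))) * F (Suc (card (leaves N f)))"
    using L by (simp add: card_Diff_subset finite_leaves of_nat_diff card_leaves_le)
  finally show "(\<Sum>k\<in>{1..N}. F (card (leaves (Suc N) (f(Suc N := k)))))
     = real (card (leaves N f)) * F (card (leaves N f))
         + (real N - real (card (leaves N f))) * F (Suc (card (leaves N f)))" .
qed

lemma sum_recursive_trees_2_card_leaves:
  fixes F :: "nat \<Rightarrow> real"
  shows "(\<Sum>f\<in>recursive_trees 2. F (card (leaves 2 f))) = F 1"
proof -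
  have "leaves 2 ((\<lambda>_. undefined)(2 := 1)) = {2}"
    unfolding leaves_def by (auto simp: numeral_2_eq_2)
  then show ?thesis by (simp add: recursive_trees_2)
qed

lemma card_recursive_trees_Suc:
  "N \<ge> 1 \<Longrightarrow> real (card (recursive_trees (Suc N))) = real N * real (card (recursive_trees N))"
  unfolding card_recursive_trees by (simp add: mult.commute)

text \<open>
  The mean number \<open>L\<^sub>N\<close> of leaves satisfies \<open>L\<^sub>N\<^sub>+\<^sub>1 = (1 - 1 / N) L\<^sub>N + 1\<close>, and \<open>N / 2\<close> solves this recursion
  with the initial value \<open>L\<^sub>2 = 1\<close>.
\<close>

lemma sum_card_leaves:
  assumes "N \<ge> 2"
  shows "(\<Sum>f\<in>recursive_trees N. real (card (leaves N f))) = real N / 2 * real (card (recursive_trees N))"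
  using assms
proof (induction N rule: dec_induct)
  case base
  show ?case using sum_recursive_trees_2_card_leaves[of real] by (simp add: recursive_trees_2 fun_upd_def)
next
  case (step N)
  have "(\<Sum>f\<in>recursive_trees (Suc N). real (card (leaves (Suc N) f)))
      = (\<Sum>f\<in>recursive_trees N. (real N - 1) * real (card (leaves N f)) + real N)"
    using step.hyps by (subst sum_recursive_trees_Suc_card_leaves) (auto intro!: sum.cong simp: algebra_simps)
  also have "\<dots> = (real N - 1) * (\<Sum>f\<in>recursive_trees N. real (card (leaves N f)))
      + real N * real (card (recursive_trees N))"
    by (simp add: sum.distrib sum_distrib_left)
  also have "\<dots> = real (Suc N) / 2 * real (card (recursive_trees (Suc N)))"
    using step by (simp add: card_recursive_trees_Suc field_simps)
  finally show ?case .
qed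

text \<open>
  Given a tree with \<open>L\<close> leaves among \<open>N\<close> vertices, the next vertex multiplies \<open>\<rho> ^ L\<close> by
  \<open>\<rho> + (1 - \<rho>) * L / N\<close> on average. This factor increases with \<open>L\<close> while \<open>\<rho> ^ L\<close> decreases, so by
  association it may be replaced by its mean, which is \<open>(1 + \<rho>) / 2\<close> because \<open>L\<close> has mean \<open>N / 2\<close>.
\<close>

lemma sum_power_card_leaves_le:
  assumes "N \<ge> 2" and \<rho>: "0 \<le> \<rho>" "\<rho> \<le> 1"
  shows "(\<Sum>f\<in>recursive_trees N. \<rho> ^ card (leaves N f))
    \<le> ((1 + \<rho>) / 2) ^ (N - 2) * real (card (recursive_trees N))"
  using assms(1)
proof (induction N rule: dec_induct)
  case base
  show ?case using sum_recursive_trees_2_card_leaves[of "\<lambda>k. \<rho> ^ k"] \<rho> by (simp add: recursive_trees_2 fun_upd_def)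
next
  case (step N)
  let ?T = "recursive_trees N" and ?c = "\<lambda>f. card (leaves N f)"
  have "real (card ?T) * (\<Sum>f\<in>?T. \<rho> ^ ?c f * real (?c f)) \<le> (\<Sum>f\<in>?T. \<rho> ^ ?c f) * (\<Sum>f\<in>?T. real (?c f))"
  proof (rule sum_mult_le_of_opposite_order)
    fix f g
    show "(\<rho> ^ ?c f - \<rho> ^ ?c g) * (real (?c f) - real (?c g)) \<le> 0"
      using \<rho> by (cases "?c f \<le> ?c g") (auto simp: mult_le_0_iff intro!: power_decreasing)
  qed
  also have "\<dots> = real (card ?T) * (real N / 2 * (\<Sum>f\<in>?T. \<rho> ^ ?c f))"
    using step.hyps by (simp add: sum_card_leaves)
  finally have cheb: "(\<Sum>f\<in>?T. \<rho> ^ ?c f * real (?c f)) \<le> real N / 2 * (\<Sum>f\<in>?T. \<rho> ^ ?c f)"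
    using card_recursive_trees_pos[of N] by simp
  have "(\<Sum>f\<in>recursive_trees (Suc N). \<rho> ^ card (leaves (Suc N) f))
      = (\<Sum>f\<in>?T. real N * \<rho> * \<rho> ^ ?c f + (1 - \<rho>) * (\<rho> ^ ?c f * real (?c f)))"
    using step.hyps by (subst sum_recursive_trees_Suc_card_leaves) (auto intro!: sum.cong simp: algebra_simps)
  also have "\<dots> = real N * \<rho> * (\<Sum>f\<in>?T. \<rho> ^ ?c f) + (1 - \<rho>) * (\<Sum>f\<in>?T. \<rho> ^ ?c f * real (?c f))"
    by (simp add: sum.distrib sum_distrib_left)
  also have "\<dots> \<le> real N * \<rho> * (\<Sum>f\<in>?T. \<rho> ^ ?c f) + (1 - \<rho>) * (real N / 2 * (\<Sum>f\<in>?T. \<rho> ^ ?c f))"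
    using cheb \<rho> by (intro add_left_mono mult_left_mono) auto
  also have "\<dots> = real N * ((1 + \<rho>) / 2) * (\<Sum>f\<in>?T. \<rho> ^ ?c f)"
    by (simp add: field_simps)
  also have "\<dots> \<le> real N * ((1 + \<rho>) / 2) * (((1 + \<rho>) / 2) ^ (N - 2) * real (card ?T))"
    using step.IH \<rho> by (intro mult_left_mono) auto
  also have "\<dots> = ((1 + \<rho>) / 2) ^ (Suc N - 2) * real (card (recursive_trees (Suc N)))"
  proof -
    have "Suc N - 2 = Suc (N - 2)" using step.hyps by simp
    then show ?thesis
      using step.hyps by (simp only: card_recursive_trees_Suc power_Suc) (simp add: card_recursive_trees_Suc)
  qed
  finally show ?case .
qed

section \<open>The characteristic function of one step\<close>

definition step_weight :: "real \<Rightarrow> real ^ 'd \<Rightarrow> real ^ 'd \<Rightarrow> real" where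
  "step_weight p u v = (if v = u then p else (1 - p) / (2 * real CARD('d) - 1))"

lemma step_weight_nonneg: "0 \<le> p \<Longrightarrow> p \<le> 1 \<Longrightarrow> step_weight p (u :: real ^ 'd :: finite) v \<ge> 0"
  using zero_less_card_finite[where 'a = 'd] by (auto simp: step_weight_def simp del: zero_less_card_finite intro!: divide_nonneg_nonneg)

lemma unit_steps_eq: "unit_steps = range (\<lambda>i. axis i 1) \<union> range (\<lambda>i. - axis i 1)"
  by (auto simp: unit_steps_def)

lemma finite_unit_steps: "finite (unit_steps :: (real ^ 'd :: finite) set)"
  by (simp add: unit_steps_eq)

lemma axis_neq_uminus_axis: "axis i 1 \<noteq> - (axis j 1 :: real ^ 'd)"
  by (auto simp: vec_eq_iff axis_def dest!: spec[of _ i] split: if_splits)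

lemma card_unit_steps: "card (unit_steps :: (real ^ 'd :: finite) set) = 2 * CARD('d)"
proof -
  have 1: "inj (\<lambda>i::'d. axis i (1::real))" by (auto simp: inj_on_def axis_eq_axis)
  have 2: "inj (\<lambda>i::'d. - axis i (1::real))" by (auto simp: inj_on_def axis_eq_axis)
  have "range (\<lambda>i::'d. axis i (1::real)) \<inter> range (\<lambda>i. - axis i 1) = {}"
    using axis_neq_uminus_axis by blast
  then show ?thesis
    unfolding unit_steps_eq by (subst card_Un_disjoint) (simp_all add: card_image[OF 1] card_image[OF 2])
qed

lemma sum_step_weight:
  assumes "u \<in> unit_steps"
  shows "(\<Sum>v\<in>unit_steps. step_weight p u v) = (1 :: real)"
proof -
  have "(\<Sum>v\<in>unit_steps. step_weight p u v) = p + (\<Sum>v\<in>unit_steps - {u}. (1 - p) / (2 * real CARD('a) - 1))"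
    using assms finite_unit_steps by (subst sum.remove[of _ u]) (auto simp: step_weight_def intro!: sum.cong)
  also have "\<dots> = p + (2 * real CARD('a) - 1) * ((1 - p) / (2 * real CARD('a) - 1))"
    using assms zero_less_card_finite[where 'a = 'a]
    by (simp add: card_Diff_singleton card_unit_steps of_nat_diff del: zero_less_card_finite)
  also have "\<dots> = 1"
    using zero_less_card_finite[where 'a = 'a] by (simp del: zero_less_card_finite)
  finally show ?thesis .
qed

text \<open>
  The sum \<open>cis x + cis y + cis (- y)\<close> has norm \<open>3\<close> only if \<open>cis x\<close> is \<open>1\<close> and \<open>cis y\<close> is \<open>1\<close>, or both
  are \<open>-1\<close>; the term \<open>sin x\<close> vanishes in both cases, which reflects that the walk changes its parity
  at every step.
\<close>

lemma norm_cis_add_2_cos_le: "norm (cis x + complex_of_real (2 * cos y)) \<le> 3 - (sin x)\<^sup>2 / 3"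
proof (rule power2_le_imp_le)
  have c: "\<bar>cos x\<bar> \<le> 1" "\<bar>cos y\<bar> \<le> 1" by auto
  have "(norm (cis x + complex_of_real (2 * cos y)))\<^sup>2 = (cos x + 2 * cos y)\<^sup>2 + (sin x)\<^sup>2"
    by (simp add: cmod_power2)
  also have "\<dots> = (cos x)\<^sup>2 + (sin x)\<^sup>2 + 4 * (cos x * cos y) + 4 * (cos y)\<^sup>2"
    by (simp add: power2_eq_square algebra_simps)
  also have "\<dots> \<le> 5 + 4 * \<bar>cos x\<bar>"
  proof -
    have "\<bar>cos x * cos y\<bar> \<le> \<bar>cos x\<bar> * 1" unfolding abs_mult using c by (intro mult_left_mono) auto
    moreover have "(cos y)\<^sup>2 \<le> 1" using c by (simp add: abs_square_le_1)
    moreover have "(cos x)\<^sup>2 + (sin x)\<^sup>2 = 1" by simp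
    ultimately show ?thesis by linarith
  qed
  also have "\<dots> \<le> 9 - 2 * (sin x)\<^sup>2"
  proof -
    have "(sin x)\<^sup>2 = (1 + \<bar>cos x\<bar>) * (1 - \<bar>cos x\<bar>)"
      by (simp add: sin_squared_eq power2_eq_square algebra_simps)
    also have "\<dots> \<le> 2 * (1 - \<bar>cos x\<bar>)" using c by (intro mult_right_mono) auto
    finally show ?thesis by argo
  qed
  also have "\<dots> \<le> (3 - (sin x)\<^sup>2 / 3)\<^sup>2"
    by (simp add: power2_diff)
  finally show "(norm (cis x + complex_of_real (2 * cos y)))\<^sup>2 \<le> (3 - (sin x)\<^sup>2 / 3)\<^sup>2" .
  have "(sin x)\<^sup>2 \<le> 1" by (simp add: abs_square_le_1)
  then show "0 \<le> 3 - (sin x)\<^sup>2 / 3" by linarith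
qed

text \<open>
  The step \<open>u\<close> of the parent is the only one whose weight may differ from \<open>q\<close>, and it may even vanish.
  In dimension at least \<open>3\<close> one can still find three steps of weight \<open>q\<close>: one of \<open>\<pm>e\<^sub>j\<close>, and both of
  \<open>\<pm>e\<^sub>k\<close> for an axis \<open>k\<close> that is neither \<open>j\<close> nor the axis of \<open>u\<close>. Their joint cancellation suffices.
\<close>

lemma norm_step_char_le_sin:
  fixes t u :: "real ^ 'd :: finite" and j :: 'd
  assumes d: "CARD('d) \<ge> 3" and p: "0 \<le> p" "p \<le> 1" and u: "u \<in> unit_steps"
  defines "q \<equiv> (1 - p) / (2 * real CARD('d) - 1)"
  shows "norm (\<Sum>v\<in>unit_steps. step_weight p u v * cis (t \<bullet> v)) \<le> 1 - q / 3 * (sin (t $ j))\<^sup>2"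
proof -
  let ?e = "\<lambda>i. axis i 1 :: real ^ 'd"
  let ?g = "\<lambda>v. of_real (step_weight p u v) * cis (t \<bullet> v)"
  have q: "q \<ge> 0" using d p by (auto simp: q_def)
  obtain i where i: "u = ?e i \<or> u = - ?e i" using u by (auto simp: unit_steps_def)
  have "card {i, j} < CARD('d)" using d card_insert_le_m1[of 2 "{j}" i] by simp
  then have "{i, j} \<noteq> UNIV" by auto
  then obtain k where k: "k \<noteq> i" "k \<noteq> j" by auto
  \<comment> \<open>Among \<open>e\<^sub>j\<close> and \<open>-e\<^sub>j\<close>, take one that differs from the step of the parent.\<close>
  define a where "a = (if u = ?e j then - ?e j else ?e j)"
  let ?A = "{a, ?e k, - ?e k}"
  have a: "a \<noteq> u" "a \<noteq> ?e k" "a \<noteq> - ?e k" "a = ?e j \<or> a = - ?e j" "a \<in> unit_steps"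
    using k axis_neq_uminus_axis[of j j] axis_neq_uminus_axis[of j k] axis_neq_uminus_axis[of k j]
    by (auto simp: a_def unit_steps_def axis_eq_axis)
  have ek: "?e k \<noteq> u" "- ?e k \<noteq> u" "?e k \<noteq> - ?e k" "?e k \<in> unit_steps" "- ?e k \<in> unit_steps"
    using i k axis_neq_uminus_axis[of k k] axis_neq_uminus_axis[of k i] axis_neq_uminus_axis[of i k]
    by (auto simp: unit_steps_def axis_eq_axis)
  have A: "?A \<subseteq> unit_steps" using a ek by auto
  have w: "step_weight p u v = q" if "v \<in> ?A" for v
    using that a ek by (auto simp: step_weight_def q_def)
  have sumA: "(\<Sum>v\<in>?A. h v) = h a + h (?e k) + h (- ?e k)" for h :: "real ^ 'd \<Rightarrow> 'z :: comm_monoid_add"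
    using a ek by (simp add: add.assoc)
  have split: "(\<Sum>v\<in>unit_steps. h v) = (\<Sum>v\<in>unit_steps - ?A. h v) + (\<Sum>v\<in>?A. h v)"
    for h :: "real ^ 'd \<Rightarrow> 'z :: comm_monoid_add"
    by (rule sum.subset_diff[OF A finite_unit_steps])
  obtain s where s: "cis (t \<bullet> a) = cis s" "(sin s)\<^sup>2 = (sin (t $ j))\<^sup>2"
    using a(4) by (elim disjE) (force simp: inner_axis)+
  have "(\<Sum>v\<in>?A. ?g v) = q * (cis s + complex_of_real (2 * cos (t $ k)))"
    unfolding sumA using s w
    by (simp add: inner_axis complex_eq_iff algebra_simps)
  then have "norm (\<Sum>v\<in>?A. ?g v) \<le> q * (3 - (sin (t $ j))\<^sup>2 / 3)"
    using norm_cis_add_2_cos_le[of s "t $ k"] q s(2) by (auto simp: norm_mult intro!: mult_left_mono)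
  moreover have "norm (\<Sum>v\<in>unit_steps - ?A. ?g v) \<le> (\<Sum>v\<in>unit_steps - ?A. step_weight p u v)"
    by (rule sum_norm_le) (simp add: norm_mult step_weight_nonneg p)
  moreover have "(\<Sum>v\<in>unit_steps - ?A. step_weight p u v) = 1 - 3 * q"
  proof -
    have "(\<Sum>v\<in>?A. step_weight p u v) = 3 * q" unfolding sumA using w by simp
    then show ?thesis using split[of "step_weight p u"] sum_step_weight[OF u, of p] by linarith
  qed
  ultimately have "norm (\<Sum>v\<in>unit_steps. ?g v) \<le> (1 - 3 * q) + q * (3 - (sin (t $ j))\<^sup>2 / 3)"
    unfolding split[of ?g] by (intro order_trans[OF norm_triangle_ineq] add_mono) auto
  also have "\<dots> = 1 - q / 3 * (sin (t $ j))\<^sup>2" by (simp add: algebra_simps)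
  finally show ?thesis .
qed

text \<open>
  The average over \<open>j\<close> of the bounds of the preceding lemma.
\<close>

definition char_bound :: "real \<Rightarrow> real ^ 'd \<Rightarrow> real" where
  "char_bound p t = 1 - (1 - p) / (2 * real CARD('d) - 1) / (3 * real CARD('d)) * (\<Sum>j\<in>UNIV. (sin (t $ j))\<^sup>2)"

lemma norm_step_char_le:
  fixes t u :: "real ^ 'd :: finite"
  assumes d: "CARD('d) \<ge> 3" and p: "0 \<le> p" "p \<le> 1" and u: "u \<in> unit_steps"
  shows "norm (\<Sum>v\<in>unit_steps. step_weight p u v * cis (t \<bullet> v)) \<le> char_bound p t" (is "?n \<le> _")
proof -
  let ?q = "(1 - p) / (2 * real CARD('d) - 1)"
  have "real CARD('d) * ?n = (\<Sum>j\<in>(UNIV :: 'd set). ?n)" by simp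
  also have "\<dots> \<le> (\<Sum>j\<in>UNIV. 1 - ?q / 3 * (sin (t $ j))\<^sup>2)"
    by (intro sum_mono norm_step_char_le_sin assms)
  also have "\<dots> = real CARD('d) - ?q / 3 * (\<Sum>j\<in>UNIV. (sin (t $ j))\<^sup>2)"
    by (simp add: sum_subtractf sum_distrib_left)
  also have "\<dots> = real CARD('d) * char_bound p t"
    using d by (simp add: char_bound_def right_diff_distrib)
  finally show ?thesis using d by (simp add: mult_le_cancel_left_pos)
qed

section \<open>The tree expansion of the law of the history\<close>

text \<open>
  For fixed values on \<open>Q\<close>, the coordinates in \<open>L\<close> are independent, each depending on one coordinate
  in \<open>Q\<close> only, and can be summed out separately.
\<close>

lemma sum_PiE_Un_prod:
  fixes \<psi> :: "'i \<Rightarrow> 'b \<Rightarrow> 'b \<Rightarrow> 'z :: comm_semiring_1"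
  assumes QL: "Q \<inter> L = {}" and L: "finite L" "\<And>m. m \<in> L \<Longrightarrow> finite (B m)"
    and f: "\<And>m. m \<in> L \<Longrightarrow> f m \<in> Q"
    and G: "\<And>h h'. (\<And>m. m \<in> Q \<Longrightarrow> h m = h' m) \<Longrightarrow> G h = G h'"
  shows "(\<Sum>h\<in>PiE (Q \<union> L) B. G h * (\<Prod>m\<in>L. \<psi> m (h (f m)) (h m)))
    = (\<Sum>a\<in>PiE Q B. G a * (\<Prod>m\<in>L. \<Sum>v\<in>B m. \<psi> m (a (f m)) v))"
proof -
  have 1: "G (merge Q L (a, b)) = G a" for a b
    by (rule G) (simp add: merge_def)
  have 2: "(\<Prod>m\<in>L. \<psi> m (merge Q L (a, b) (f m)) (merge Q L (a, b) m)) = (\<Prod>m\<in>L. \<psi> m (a (f m)) (b m))" for a b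
    using QL f by (intro prod.cong refl) (auto simp: merge_def)
  show ?thesis
    unfolding sum_PiE_Un[OF QL] 1 2 using L
    by (simp add: prod_sum_PiE sum_distrib_left)
qed

text \<open>
  Fixing the first step in the range of the functions keeps the initial condition out of the weights.
\<close>

definition histories :: "'d :: finite \<Rightarrow> nat \<Rightarrow> (nat \<Rightarrow> real ^ 'd) set" where
  "histories i\<^sub>1 N = (\<Pi>\<^sub>E m\<in>{1..N}. if m = 1 then {axis i\<^sub>1 1} else unit_steps)"

text \<open>
  The probability of the steps \<open>h\<close> when the choices of remembered times are given by \<open>f\<close>: a Markov
  chain indexed by the tree \<open>f\<close>.
\<close>

definition tree_weight :: "real \<Rightarrow> nat \<Rightarrow> (nat \<Rightarrow> nat) \<Rightarrow> (nat \<Rightarrow> real ^ 'd) \<Rightarrow> real" where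
  "tree_weight p N f h = (\<Prod>m\<in>{2..N}. step_weight p (h (f m)) (h m))"

lemma axis_in_unit_steps: "axis i 1 \<in> unit_steps"
  by (auto simp: unit_steps_def)

lemma history_in_unit_steps: "h \<in> histories i\<^sub>1 N \<Longrightarrow> m \<in> {1..N} \<Longrightarrow> h m \<in> unit_steps"
  using axis_in_unit_steps[of i\<^sub>1] PiE_mem[of h "{1..N}" _ m] by (fastforce simp: histories_def split: if_splits)

lemma finite_histories: "finite (histories i\<^sub>1 N)"
  unfolding histories_def by (intro finite_PiE) (auto simp: finite_unit_steps)

text \<open>
  The latest vertex is remembered by no other one, so its step can be summed out; this removes its
  factor from the weight.
\<close>

lemma sum_tree_weight:
  assumes f: "\<And>m. m \<in> {2..N} \<Longrightarrow> f m \<in> {1..<m}" and N: "N \<ge> 1"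
  shows "(\<Sum>h\<in>histories i\<^sub>1 N. tree_weight p N f h) = 1"
  using N f
proof (induction N rule: dec_induct)
  case base
  have "{1..1::nat} = insert 1 {}" by auto
  then show ?case
    by (simp add: histories_def tree_weight_def PiE_insert_eq)
next
  case (step N)
  let ?B = "\<lambda>m::nat. if m = 1 then {axis i\<^sub>1 1} else unit_steps :: (real ^ 'a) set"
  have eq: "{1..Suc N} = {1..N} \<union> {Suc N}" "{2..Suc N} = {2..N} \<union> {Suc N}" using step.hyps by auto
  have fN: "f (Suc N) \<in> {1..N}" using step.prems[of "Suc N"] step.hyps by auto
  have aN: "a (f (Suc N)) \<in> unit_steps" if "a \<in> PiE {1..N} ?B" for a
    using history_in_unit_steps[of a i\<^sub>1 N, OF _ fN] that by (simp only: histories_def)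
  have fm: "f m \<in> {1..N}" if "m \<in> {2..N}" for m using step.prems[of m] that by auto
  have "(\<Sum>h\<in>histories i\<^sub>1 (Suc N). tree_weight p (Suc N) f h)
      = (\<Sum>h\<in>PiE ({1..N} \<union> {Suc N}) ?B. tree_weight p N f h * (\<Prod>m\<in>{Suc N}. step_weight p (h (f m)) (h m)))"
    unfolding histories_def eq(1) tree_weight_def eq(2)
    by (intro sum.cong refl, subst prod.union_disjoint) auto
  also have "\<dots> = (\<Sum>a\<in>PiE {1..N} ?B. tree_weight p N f a * (\<Prod>m\<in>{Suc N}. \<Sum>v\<in>?B m. step_weight p (a (f m)) v))"
  proof (rule sum_PiE_Un_prod)
    fix h h' :: "nat \<Rightarrow> real ^ 'a"
    assume "\<And>m. m \<in> {1..N} \<Longrightarrow> h m = h' m"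
    then show "tree_weight p N f h = tree_weight p N f h'"
      unfolding tree_weight_def using fm by (intro prod.cong arg_cong2[where f = "step_weight p"]) auto
  qed (use fN finite_unit_steps in auto)
  also have "\<dots> = (\<Sum>a\<in>histories i\<^sub>1 N. tree_weight p N f a)"
    unfolding histories_def
    using aN step.hyps by (intro sum.cong refl) (simp add: sum_step_weight)
  also have "\<dots> = 1" using step by auto
  finally show ?case .
qed

text \<open>
  Given the tree and the steps at its inner vertices, the steps at the leaves are independent. So the
  characteristic function of the endpoint contains one factor of norm at most \<open>char_bound p t\<close> for
  each leaf, whatever the inner vertices do.
\<close>

lemma norm_sum_tree_weight_le:
  fixes t :: "real ^ 'd :: finite"
  assumes d: "CARD('d) \<ge> 3" and p: "0 \<le> p" "p \<le> 1" and N: "N \<ge> 2" and f: "f \<in> recursive_trees N"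
  shows "norm (\<Sum>h\<in>histories i\<^sub>1 N. tree_weight p N f h * (\<Prod>m\<in>{1..N}. cis (t \<bullet> h m)))
    \<le> char_bound p t ^ card (leaves N f)"
proof -
  let ?B = "\<lambda>m::nat. if m = 1 then {axis i\<^sub>1 1} else unit_steps :: (real ^ 'd) set"
  define L where "L = leaves N f"
  define Q where "Q = {1..N} - L"
  define W where "W h = (\<Prod>m\<in>{2..N} - L. step_weight p (h (f m)) (h m))" for h :: "nat \<Rightarrow> real ^ 'd"
  have fm: "f m \<in> {1..<m}" if "m \<in> {2..N}" for m
    using f that by (auto simp: recursive_trees_def PiE_def Pi_def)
  have "1 \<notin> L" using fm[of 2] N by (force simp: L_def leaves_def)
  have L: "L \<subseteq> {2..N}"
  proof
    fix m assume "m \<in> L"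
    with \<open>1 \<notin> L\<close> have "m \<noteq> 1" "m \<in> {1..N}" by (auto simp: L_def leaves_def)
    then show "m \<in> {2..N}" by auto
  qed
  have finL: "finite L" by (simp add: L_def finite_leaves)
  have fQ: "f m \<in> Q" if "m \<in> {2..N}" for m
    using fm[OF that] that by (auto simp: Q_def L_def leaves_def)
  have QL: "Q \<inter> L = {}" "{1..N} = Q \<union> L" using L by (auto simp: Q_def)
  have H: "histories i\<^sub>1 N = PiE (Q \<union> L) ?B" unfolding histories_def QL(2)[symmetric] ..
  have finB: "finite (?B m)" for m by (simp add: finite_unit_steps)
  have BL: "?B m = unit_steps" if "m \<in> L" for m using that L by auto
  have aQ: "a m \<in> unit_steps" if "a \<in> PiE Q ?B" "m \<in> Q" for a m
    using PiE_mem[OF that] by (auto simp: axis_in_unit_steps split: if_splits)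
  have W_cong: "W h = W h'" if "\<And>m. m \<in> Q \<Longrightarrow> h m = h' m" for h h'
    unfolding W_def using fQ that by (intro prod.cong arg_cong2[where f = "step_weight p"]) (auto simp: Q_def)
  have W_nonneg: "W h \<ge> 0" for h
    unfolding W_def by (intro prod_nonneg step_weight_nonneg p ballI)
  have weight: "tree_weight p N f h = W h * (\<Prod>m\<in>L. step_weight p (h (f m)) (h m))" for h
    unfolding W_def tree_weight_def by (rule prod.subset_diff[OF L]) simp
  \<comment> \<open>Summing out the leaves without the characters shows that the inner vertices carry total mass \<open>1\<close>.\<close>
  have sum_W: "(\<Sum>a\<in>PiE Q ?B. W a) = 1"
  proof -
    have "1 = (\<Sum>h\<in>PiE (Q \<union> L) ?B. W h * (\<Prod>m\<in>L. step_weight p (h (f m)) (h m)))"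
      unfolding H[symmetric] weight[symmetric] using fm N by (intro sum_tree_weight[symmetric]) auto
    also have "\<dots> = (\<Sum>a\<in>PiE Q ?B. W a * (\<Prod>m\<in>L. \<Sum>v\<in>?B m. step_weight p (a (f m)) v))"
    proof (rule sum_PiE_Un_prod)
      show "f m \<in> Q" if "m \<in> L" for m using fQ that L by blast
      show "W h = W h'" if "\<And>m. m \<in> Q \<Longrightarrow> h m = h' m" for h h'
        by (rule W_cong) (rule that)
    qed (use QL(1) finL finB in simp_all)
    also have "\<dots> = (\<Sum>a\<in>PiE Q ?B. W a)"
      using fQ L aQ BL by (intro sum.cong refl) (auto simp: sum_step_weight subset_iff)
    finally show ?thesis ..
  qed
  have "(\<Sum>h\<in>histories i\<^sub>1 N. tree_weight p N f h * (\<Prod>m\<in>{1..N}. cis (t \<bullet> h m)))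
      = (\<Sum>h\<in>PiE (Q \<union> L) ?B. (W h * (\<Prod>m\<in>Q. cis (t \<bullet> h m)))
          * (\<Prod>m\<in>L. of_real (step_weight p (h (f m)) (h m)) * cis (t \<bullet> h m)))"
    unfolding H QL(2) weight using QL(1) finL
    by (subst prod.union_disjoint) (auto simp: Q_def prod.distrib mult_ac)
  also have "\<dots> = (\<Sum>a\<in>PiE Q ?B. (W a * (\<Prod>m\<in>Q. cis (t \<bullet> a m)))
          * (\<Prod>m\<in>L. \<Sum>v\<in>?B m. of_real (step_weight p (a (f m)) v) * cis (t \<bullet> v)))"
  proof (rule sum_PiE_Un_prod)
    fix h h' :: "nat \<Rightarrow> real ^ 'd"
    assume "\<And>m. m \<in> Q \<Longrightarrow> h m = h' m"
    then show "W h * (\<Prod>m\<in>Q. cis (t \<bullet> h m)) = W h' * (\<Prod>m\<in>Q. cis (t \<bullet> h' m))"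
      using W_cong[of h h'] by simp
  next
    show "f m \<in> Q" if "m \<in> L" for m using fQ that L by blast
  qed (use QL(1) finL finB in simp_all)
  also have "norm \<dots> \<le> (\<Sum>a\<in>PiE Q ?B. W a * char_bound p t ^ card L)"
  proof (rule sum_norm_le)
    fix a assume a: "a \<in> PiE Q ?B"
    have "norm ((W a * (\<Prod>m\<in>Q. cis (t \<bullet> a m)))
          * (\<Prod>m\<in>L. \<Sum>v\<in>?B m. of_real (step_weight p (a (f m)) v) * cis (t \<bullet> v)))
        = W a * (\<Prod>m\<in>L. norm (\<Sum>v\<in>unit_steps. of_real (step_weight p (a (f m)) v) * cis (t \<bullet> v)))"
      using BL by (simp add: norm_mult prod_norm[symmetric] W_nonneg)
    also have "\<dots> \<le> W a * (\<Prod>m\<in>L. char_bound p t)"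
      using a aQ fQ L by (intro mult_left_mono prod_mono W_nonneg conjI norm_ge_zero norm_step_char_le d p) auto
    finally show "norm ((W a * (\<Prod>m\<in>Q. cis (t \<bullet> a m)))
          * (\<Prod>m\<in>L. \<Sum>v\<in>?B m. of_real (step_weight p (a (f m)) v) * cis (t \<bullet> v)))
        \<le> W a * char_bound p t ^ card L" by simp
  qed
  also have "\<dots> = char_bound p t ^ card (leaves N f)"
    unfolding sum_distrib_right[symmetric] sum_W L_def by simp
  finally show ?thesis .
qed

text \<open>
  Each step is drawn by remembering a uniform earlier time. Expanding the product of these sums turns
  the law into an average over recursive trees.
\<close>

definition history_law :: "real \<Rightarrow> nat \<Rightarrow> (nat \<Rightarrow> real ^ 'd) \<Rightarrow> real" where
  "history_law p N h = (\<Prod>m\<in>{2..N}. (\<Sum>k\<in>{1..<m}. step_weight p (h k) (h m)) / real (m - 1))"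

lemma history_law_nonneg: "0 \<le> p \<Longrightarrow> p \<le> 1 \<Longrightarrow> history_law p N (h :: nat \<Rightarrow> real ^ 'd :: finite) \<ge> 0"
  unfolding history_law_def by (intro prod_nonneg ballI divide_nonneg_nonneg sum_nonneg step_weight_nonneg) auto

lemma history_law_eq:
  "history_law p N h = (\<Sum>f\<in>recursive_trees N. tree_weight p N f h) / real (card (recursive_trees N))"
  unfolding history_law_def tree_weight_def prod_dividef card_recursive_trees
  by (subst prod_sum_PiE) (simp_all add: recursive_trees_def)

lemma sum_history_law:
  assumes "N \<ge> 1"
  shows "(\<Sum>h\<in>histories i\<^sub>1 N. history_law p N h) = 1"
proof -
  have "(\<Sum>h\<in>histories i\<^sub>1 N. history_law p N h)
      = (\<Sum>f\<in>recursive_trees N. \<Sum>h\<in>histories i\<^sub>1 N. tree_weight p N f h) / real (card (recursive_trees N))"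
    unfolding history_law_eq by (simp add: sum.swap[of _ "recursive_trees N"] flip: sum_divide_distrib)
  also have "(\<Sum>f\<in>recursive_trees N. \<Sum>h\<in>histories i\<^sub>1 N. tree_weight p N f h) = (\<Sum>f\<in>recursive_trees N. 1)"
    using assms by (intro sum.cong refl sum_tree_weight) (auto simp: recursive_trees_def PiE_def Pi_def)
  finally show ?thesis using card_recursive_trees_pos[of N] by simp
qed

lemma char_bound_bounds:
  assumes d: "CARD('d :: finite) \<ge> 3" and p: "0 \<le> p" "p \<le> 1"
  shows "0 \<le> char_bound p (t :: real ^ 'd)" "char_bound p t \<le> 1"
proof -
  \<comment> \<open>Nonnegativity holds because this is an upper bound of a norm, whatever the step of the parent.\<close>
  have "0 \<le> norm (\<Sum>v\<in>unit_steps. step_weight p (axis undefined 1 :: real ^ 'd) v * cis (t \<bullet> v))" by simp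
  also have "\<dots> \<le> char_bound p t" by (intro norm_step_char_le assms axis_in_unit_steps)
  finally show "0 \<le> char_bound p t" .
  show "char_bound p t \<le> 1"
    unfolding char_bound_def using p d by (simp add: sum_nonneg)
qed

text \<open>
  The law of the history is a uniform average over trees, so the bound for a single tree is averaged
  over the number of leaves.
\<close>

lemma norm_char_history_law_le:
  fixes t :: "real ^ 'd :: finite"
  assumes d: "CARD('d) \<ge> 3" and p: "0 \<le> p" "p \<le> 1" and N: "N \<ge> 2"
  shows "norm (\<Sum>h\<in>histories i\<^sub>1 N. history_law p N h * (\<Prod>m\<in>{1..N}. cis (t \<bullet> h m)))
    \<le> ((1 + char_bound p t) / 2) ^ (N - 2)"
proof -
  let ?T = "recursive_trees N"
  let ?F = "\<lambda>f h. tree_weight p N f h * (\<Prod>m\<in>{1..N}. cis (t \<bullet> h m))"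
  have "(\<Sum>h\<in>histories i\<^sub>1 N. history_law p N h * (\<Prod>m\<in>{1..N}. cis (t \<bullet> h m)))
      = (\<Sum>h\<in>histories i\<^sub>1 N. \<Sum>f\<in>?T. ?F f h / real (card ?T))"
    unfolding history_law_eq by (simp add: sum_distrib_right sum_divide_distrib)
  also have "\<dots> = (\<Sum>f\<in>?T. \<Sum>h\<in>histories i\<^sub>1 N. ?F f h) / real (card ?T)"
    by (subst sum.swap) (simp add: sum_divide_distrib)
  also have "norm \<dots> = norm (\<Sum>f\<in>?T. \<Sum>h\<in>histories i\<^sub>1 N. ?F f h) / real (card ?T)"
    by (simp add: norm_divide)
  also have "\<dots> \<le> (\<Sum>f\<in>?T. char_bound p t ^ card (leaves N f)) / real (card ?T)"
    by (rule divide_right_mono, rule sum_norm_le, rule norm_sum_tree_weight_le[OF d p N]) simp_all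
  also have "\<dots> \<le> ((1 + char_bound p t) / 2) ^ (N - 2) * real (card ?T) / real (card ?T)"
    by (intro divide_right_mono sum_power_card_leaves_le N char_bound_bounds d p) auto
  also have "\<dots> = ((1 + char_bound p t) / 2) ^ (N - 2)"
    using card_recursive_trees_pos[of N] by simp
  finally show ?thesis .
qed

section \<open>Discrete Fourier inversion\<close>

text \<open>
  For odd \<open>K\<close> these are the frequencies of the discrete Fourier transform of order \<open>K\<close>, enumerated
  with the stride \<open>(K + 1) / 2\<close>, the inverse of \<open>2\<close> modulo \<open>K\<close>. In this order \<open>sin\<^sup>2\<close> becomes
  \<open>sin\<^sup>2 (\<pi> r / K)\<close>, whose only zero on the whole period is \<open>r = 0\<close>: the two peaks that
  the parity of the walk creates near \<open>0\<close> and \<open>\<pi>\<close> are interleaved into a single one.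
\<close>

definition fourier_angle :: "nat \<Rightarrow> nat \<Rightarrow> real" where
  "fourier_angle K r = pi * real r * (real K + 1) / real K"

lemma sin_fourier_angle:
  assumes "K > 0"
  shows "(sin (fourier_angle K r))\<^sup>2 = (sin (pi * real r / real K))\<^sup>2"
proof -
  have "fourier_angle K r = pi * real r / real K + real r * pi"
    using assms by (simp add: fourier_angle_def field_simps)
  moreover have "sin (real r * pi) = 0" by simp
  moreover have "(cos (real r * pi))\<^sup>2 = 1" by (simp add: cos_npi power_mult[symmetric] mult.commute[of r 2])
  ultimately show ?thesis by (simp add: sin_add power_mult_distrib)
qed

text \<open>
  The summands are the powers of \<open>cis \<alpha>\<close> with \<open>\<alpha> = \<pi> (K + 1) y / K\<close>. As \<open>K + 1\<close> is even, this is a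
  \<open>K\<close>-th root of unity, and it is \<open>1\<close> only if \<open>K\<close> divides \<open>(K + 1) y\<close>, hence \<open>y\<close>.
\<close>

lemma sum_cis_fourier_angle:
  assumes K: "odd K" and y: "\<bar>y\<bar> < int K"
  shows "(\<Sum>r<K. cis (fourier_angle K r * of_int y)) = (if y = 0 then of_nat K else 0)"
proof (cases "y = 0")
  case False
  have K0: "K > 0" using y by linarith
  define \<alpha> where "\<alpha> = pi * (real K + 1) * of_int y / real K"
  have "(\<Sum>r<K. cis (fourier_angle K r * of_int y)) = (\<Sum>r<K. cis \<alpha> ^ r)"
    by (simp add: Complex.DeMoivre fourier_angle_def \<alpha>_def algebra_simps)
  moreover have "cis \<alpha> \<noteq> 1"
  proof
    assume "cis \<alpha> = 1"
    then have "cos \<alpha> = 1" by (simp add: complex_eq_iff)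
    then obtain n :: int where n: "\<alpha> = of_int n * 2 * pi" using cos_one_2pi_int by blast
    then have "pi * ((real K + 1) * of_int y) = pi * (of_int n * 2 * real K)"
      using K0 unfolding \<alpha>_def by (simp add: field_simps)
    then have "(real K + 1) * of_int y = of_int n * 2 * real K" by simp
    then have "real_of_int ((int K + 1) * y) = real_of_int (n * 2 * int K)" by simp
    then have "(int K + 1) * y = n * 2 * int K" by (simp only: of_int_eq_iff)
    then have "y = int K * (2 * n - y)" by (simp add: algebra_simps)
    then have "int K dvd y" by (metis dvd_triv_left)
    with y False show False using zdvd_imp_le[of "int K" "\<bar>y\<bar>"] by auto
  qed
  moreover have "cis \<alpha> ^ K = 1"
  proof -
    obtain m where m: "K + 1 = 2 * m" using K by (metis even_Suc Suc_eq_plus1 evenE)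
    have "real K * \<alpha> = pi * (real K + 1) * of_int y" using K0 by (simp add: \<alpha>_def)
    also have "real K + 1 = 2 * real m" using arg_cong[OF m, of real] by simp
    finally have "real K * \<alpha> = 2 * pi * of_int (int m * y)" by simp
    then show ?thesis
      by (simp only: Complex.DeMoivre cis_multiple_2pi[OF Ints_of_int])
  qed
  ultimately show ?thesis using False by (simp add: geometric_sum)
qed simp

lemma cis_sum: "finite A \<Longrightarrow> cis (sum f A) = (\<Prod>x\<in>A. cis (f x))"
  by (induction A rule: finite_induct) (auto simp: cis_mult[symmetric])

definition frequency :: "nat \<Rightarrow> ('d \<Rightarrow> nat) \<Rightarrow> real ^ 'd" where
  "frequency K r = (\<chi> j. fourier_angle K (r j))"

lemma sum_cis_frequency:
  fixes y :: "'d :: finite \<Rightarrow> int"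
  assumes K: "odd K" and y: "\<And>j. \<bar>y j\<bar> < int K"
  shows "(\<Sum>r\<in>PiE UNIV (\<lambda>_. {..<K}). cis (frequency K r \<bullet> (\<chi> j. of_int (y j))))
    = (if y = (\<lambda>_. 0) then of_nat K ^ CARD('d) else 0)"
proof -
  have "(\<Sum>r\<in>PiE UNIV (\<lambda>_. {..<K}). cis (frequency K r \<bullet> (\<chi> j. of_int (y j))))
      = (\<Sum>r\<in>PiE UNIV (\<lambda>_. {..<K}). \<Prod>j\<in>UNIV. cis (fourier_angle K (r j) * of_int (y j)))"
    by (simp add: inner_vec_def frequency_def cis_sum)
  also have "\<dots> = (\<Prod>j\<in>UNIV. \<Sum>r<K. cis (fourier_angle K r * of_int (y j)))"
    by (subst prod_sum_PiE) auto
  also have "\<dots> = (\<Prod>j\<in>UNIV. if y j = 0 then of_nat K else 0)"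
    by (simp only: sum_cis_fourier_angle[OF K y])
  also have "\<dots> = (if y = (\<lambda>_. 0) then of_nat K ^ CARD('d) else 0)"
    by (auto simp: fun_eq_iff)
  finally show ?thesis .
qed

text \<open>
  Completing the square, \<open>a r\<^sup>2 \<ge> \<surd>a r - 1/4\<close>, compares the Gaussian sum with a geometric series.
\<close>

lemma sum_exp_neg_square_le:
  assumes a: "a > 0"
  shows "(\<Sum>r<K. exp (- a * (real r)\<^sup>2)) \<le> exp (1/4) * (1 + 1 / sqrt a)"
proof -
  define s where "s = sqrt a"
  have s: "s > 0" "s\<^sup>2 = a" using a by (auto simp: s_def)
  have "(\<Sum>r<K. exp (- a * (real r)\<^sup>2)) \<le> (\<Sum>r<K. exp (1/4) * exp (- s) ^ r)"
  proof (intro sum_mono)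
    fix r
    have "0 \<le> (s * real r - 1/2)\<^sup>2" by simp
    also have "\<dots> = a * (real r)\<^sup>2 - s * real r + 1/4"
      by (simp add: power2_diff power_mult_distrib s power_divide)
    finally have "- a * (real r)\<^sup>2 \<le> 1/4 + real r * - s" by (simp add: mult.commute)
    then have "exp (- a * (real r)\<^sup>2) \<le> exp (1/4 + real r * - s)" by simp
    also have "\<dots> = exp (1/4) * exp (- s) ^ r" by (simp only: exp_add exp_of_nat_mult)
    finally show "exp (- a * (real r)\<^sup>2) \<le> exp (1/4) * exp (- s) ^ r" .
  qed
  also have "\<dots> = exp (1/4) * (\<Sum>r<K. exp (- s) ^ r)" by (simp add: sum_distrib_left)
  also have "(\<Sum>r<K. exp (- s) ^ r) \<le> 1 / (1 - exp (- s))"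
    using s by (simp add: sum_gp_strict divide_right_mono)
  also have "1 / (1 - exp (- s)) \<le> 1 + 1 / s"
  proof -
    have "1 + s \<le> exp s" by (rule exp_ge_add_one_self)
    then have "exp (- s) \<le> 1 / (1 + s)" using s by (simp add: exp_minus field_simps)
    then have "1 - exp (- s) \<ge> s / (1 + s)" using s by (simp add: field_simps)
    then have "1 / (1 - exp (- s)) \<le> 1 / (s / (1 + s))" using s by (intro divide_left_mono mult_pos_pos divide_pos_pos) auto
    then show ?thesis using s by (simp add: field_simps)
  qed
  finally show ?thesis by (simp add: s_def)
qed

lemma sin_ge_half:
  assumes "0 \<le> x" "x \<le> pi / 2"
  shows "sin x \<ge> x / 2"
proof -
  have "pi < 10/3" using pi_approx by simp
  then have x: "x < 5/3" using assms by linarith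
  have "\<bar>sin x - x\<bar> \<le> x ^ 3 / 6"
    using Maclaurin_sin_bound[of x 3] assms by (simp add: numeral_3_eq_3 sin_coeff_def fact_numeral)
  then have "x - x ^ 3 / 6 \<le> sin x" by linarith
  moreover have "x ^ 3 \<le> 3 * x"
  proof -
    have "x\<^sup>2 \<le> (5/3)\<^sup>2" using x assms by (intro power_mono) auto
    then have "x\<^sup>2 \<le> 3" by (simp add: power2_eq_square)
    then have "x * x\<^sup>2 \<le> x * 3" using assms by (intro mult_left_mono) auto
    then show ?thesis by (simp add: power3_eq_cube power2_eq_square mult.assoc)
  qed
  ultimately show ?thesis by linarith
qed

text \<open>
  The sine is at least linear on each half of the period, so the sum is at most two Gaussian sums,
  one starting from each end.
\<close>

lemma sum_exp_neg_sin_square_le: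
  assumes b: "b > 0" and K: "K > 0"
  shows "(\<Sum>r<K. exp (- b * (sin (pi * real r / real K))\<^sup>2))
    \<le> 2 * exp (1/4) * (1 + real K / sqrt b)"
proof -
  define a where "a = b / (real K)\<^sup>2"
  have a: "a > 0" using assms by (simp add: a_def)
  have sin_ge: "sin (pi * real m / real K) \<ge> real m / real K" if "2 * m \<le> K" for m
  proof -
    have "real m / real K \<le> (pi * real m / real K) / 2"
      using K mult_right_mono[OF pi_ge_two, of "real m"] by (simp add: field_simps)
    also have "\<dots> \<le> sin (pi * real m / real K)"
    proof (rule sin_ge_half)
      have "2 * real m \<le> real K" using that by linarith
      then show "pi * real m / real K \<le> pi / 2" using K by (simp add: field_simps)
    qed simp
    finally show ?thesis .
  qed
  have exp_le: "exp (- b * (sin (pi * real m / real K))\<^sup>2) \<le> exp (- a * (real m)\<^sup>2)" if "2 * m \<le> K" for m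
  proof -
    have "(real m / real K)\<^sup>2 \<le> (sin (pi * real m / real K))\<^sup>2"
      using sin_ge[OF that] by (intro power_mono) auto
    then have "b * (real m / real K)\<^sup>2 \<le> b * (sin (pi * real m / real K))\<^sup>2"
      using b by (intro mult_left_mono) auto
    then show ?thesis by (simp add: a_def power_divide)
  qed
  have "(\<Sum>r<K. exp (- a * (real (K - r))\<^sup>2)) = (\<Sum>r<K. exp (- a * (real (Suc r))\<^sup>2))"
    using sum.nat_diff_reindex[of "\<lambda>r. exp (- a * (real (Suc r))\<^sup>2)" K]
    by (simp add: Suc_diff_Suc cong: sum.cong_simp)
  also have "\<dots> \<le> (\<Sum>r<Suc K. exp (- a * (real r)\<^sup>2))"
    by (subst sum.lessThan_Suc_shift) (simp del: of_nat_Suc)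
  finally have reflected: "(\<Sum>r<K. exp (- a * (real (K - r))\<^sup>2)) \<le> (\<Sum>r<Suc K. exp (- a * (real r)\<^sup>2))" .
  have "(\<Sum>r<K. exp (- b * (sin (pi * real r / real K))\<^sup>2))
      \<le> (\<Sum>r<K. exp (- a * (real r)\<^sup>2) + exp (- a * (real (K - r))\<^sup>2))"
  proof (intro sum_mono)
    fix r assume r: "r \<in> {..<K}"
    show "exp (- b * (sin (pi * real r / real K))\<^sup>2) \<le> exp (- a * (real r)\<^sup>2) + exp (- a * (real (K - r))\<^sup>2)"
    proof (cases "2 * r \<le> K")
      case True
      then show ?thesis using exp_le[OF True] by (simp add: add_increasing2)
    next
      case False
      have "pi * real (K - r) / real K = pi - pi * real r / real K"
        using r K by (simp add: of_nat_diff field_simps)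
      then have "sin (pi * real (K - r) / real K) = sin (pi * real r / real K)" by simp
      with exp_le[of "K - r"] False show ?thesis by (simp add: add_increasing)
    qed
  qed
  also have "\<dots> = (\<Sum>r<K. exp (- a * (real r)\<^sup>2)) + (\<Sum>r<K. exp (- a * (real (K - r))\<^sup>2))"
    by (simp add: sum.distrib)
  also have "\<dots> \<le> (\<Sum>r<K. exp (- a * (real r)\<^sup>2)) + (\<Sum>r<Suc K. exp (- a * (real r)\<^sup>2))"
    using reflected by (rule add_left_mono)
  also have "\<dots> \<le> exp (1/4) * (1 + 1 / sqrt a) + exp (1/4) * (1 + 1 / sqrt a)"
    by (intro add_mono sum_exp_neg_square_le a)
  also have "\<dots> = 2 * exp (1/4) * (1 + real K / sqrt b)"
    using K b by (simp add: a_def real_sqrt_divide)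
  finally show ?thesis .
qed

section \<open>A local limit bound\<close>

lemma unit_step_component:
  assumes "v \<in> unit_steps"
  shows "v $ j \<in> \<int>" "\<bar>v $ j\<bar> \<le> 1"
  using assms by (auto simp: unit_steps_def axis_def)

lemma history_endpoint:
  fixes i\<^sub>1 :: "'d :: finite"
  assumes "h \<in> histories i\<^sub>1 N"
  obtains y :: "'d \<Rightarrow> int" where "(\<Sum>m\<in>{1..N}. h m) = (\<chi> j. of_int (y j))" "\<And>j. \<bar>y j\<bar> \<le> int N"
proof -
  have "\<exists>y. (\<Sum>m\<in>{1..N}. h m) $ j = of_int y" for j
  proof -
    have "(\<Sum>m\<in>{1..N}. h m) $ j \<in> \<int>"
      unfolding sum_component by (intro Ints_sum unit_step_component(1) history_in_unit_steps[OF assms])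
    then show ?thesis by (auto elim: Ints_cases)
  qed
  then obtain y where y: "\<And>j. (\<Sum>m\<in>{1..N}. h m) $ j = of_int (y j)" by metis
  have "\<bar>y j\<bar> \<le> int N" for j
  proof -
    have "\<bar>(\<Sum>m\<in>{1..N}. h m) $ j\<bar> \<le> (\<Sum>m\<in>{1..N}. 1)"
      unfolding sum_component
      using unit_step_component(2) history_in_unit_steps[OF assms]
      by (intro order_trans[OF sum_abs] sum_mono) auto
    then have "real_of_int \<bar>y j\<bar> \<le> real_of_int (int N)" unfolding y by simp
    then show ?thesis by (simp only: of_int_le_iff)
  qed
  then show ?thesis using y by (intro that[of y]) (simp_all add: vec_eq_iff)
qed

text \<open>
  Because \<open>1 - x \<le> exp (- x)\<close>, the bound on the characteristic function splits into a product over the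
  coordinates, and the \<open>d\<close>-dimensional sum into a power of a one-dimensional one.
\<close>

lemma sum_power_char_bound_le:
  fixes K M :: nat
  assumes d: "CARD('d :: finite) \<ge> 3" and p: "0 \<le> p" "p < 1" and K: "K > 0" and M: "M > 0"
  defines "c \<equiv> (1 - p) / (2 * real CARD('d) - 1) / (6 * real CARD('d))"
  shows "(\<Sum>r\<in>PiE UNIV (\<lambda>_. {..<K}). ((1 + char_bound p (frequency K r :: real ^ 'd)) / 2) ^ M)
    \<le> (2 * exp (1/4) * (1 + real K / sqrt (c * real M))) ^ CARD('d)"
proof -
  have c: "c > 0" using d p by (simp add: c_def)
  have "((1 + char_bound p (frequency K r :: real ^ 'd)) / 2) ^ M
      \<le> (\<Prod>j\<in>UNIV. exp (- (c * real M) * (sin (pi * real (r j) / real K))\<^sup>2))" for r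
  proof -
    let ?s = "\<Sum>j\<in>UNIV. (sin (frequency K r $ j :: real))\<^sup>2"
    have "(1 + (1 - A / (3 * D) * B)) / 2 = 1 + - (A / (6 * D) * B)" for A B D :: real
      by (cases "D = 0") (auto simp: field_simps)
    then have "(1 + char_bound p (frequency K r :: real ^ 'd)) / 2 = 1 + - (c * ?s)"
      unfolding char_bound_def c_def by this
    also have "\<dots> \<le> exp (- (c * ?s))" by (rule exp_ge_add_one_self)
    finally have "((1 + char_bound p (frequency K r :: real ^ 'd)) / 2) ^ M \<le> exp (- (c * ?s)) ^ M"
      using char_bound_bounds[of p "frequency K r :: real ^ 'd"] d p by (intro power_mono) auto
    also have "\<dots> = exp (\<Sum>j\<in>UNIV. - (c * real M) * (sin (frequency K r $ j))\<^sup>2)"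
      by (simp add: sum_distrib_left sum_negf mult_ac flip: exp_of_nat_mult)
    also have "\<dots> = (\<Prod>j\<in>UNIV. exp (- (c * real M) * (sin (pi * real (r j) / real K))\<^sup>2))"
      using K by (simp add: exp_sum frequency_def sin_fourier_angle)
    finally show ?thesis .
  qed
  then have "(\<Sum>r\<in>PiE UNIV (\<lambda>_. {..<K}). ((1 + char_bound p (frequency K r :: real ^ 'd)) / 2) ^ M)
      \<le> (\<Sum>r\<in>PiE UNIV (\<lambda>_::'d. {..<K}). \<Prod>j\<in>UNIV. exp (- (c * real M) * (sin (pi * real (r j) / real K))\<^sup>2))"
    by (intro sum_mono)
  also have "\<dots> = (\<Prod>j\<in>(UNIV :: 'd set). \<Sum>r<K. exp (- (c * real M) * (sin (pi * real r / real K))\<^sup>2))"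
    by (subst prod_sum_PiE) auto
  also have "\<dots> \<le> (2 * exp (1/4) * (1 + real K / sqrt (c * real M))) ^ CARD('d)"
    using c M K unfolding prod_constant
    by (intro power_mono sum_exp_neg_sin_square_le sum_nonneg) auto
  finally show ?thesis .
qed

text \<open>
  Fourier inversion on the group of residues modulo \<open>K = 2 N + 1\<close>: this modulus separates the
  possible endpoints, whose coordinates lie between \<open>-N\<close> and \<open>N\<close>. Each coordinate contributes a
  factor of order \<open>1 / \<surd>N\<close>, as for a walk with independent steps.
\<close>

lemma endpoint_probability_le:
  fixes i\<^sub>1 :: "'d :: finite"
  assumes d: "CARD('d) \<ge> 3" and p: "0 \<le> p" "p < 1"
  shows "\<exists>C>0. \<forall>N\<ge>4. \<forall>z. (\<forall>j. \<bar>z j\<bar> \<le> int N) \<longrightarrow>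
    (\<Sum>h\<in>{h \<in> histories i\<^sub>1 N. (\<Sum>m\<in>{1..N}. h m) = (\<chi> j. of_int (z j))}. history_law p N h)
      \<le> (C / sqrt (real N)) ^ CARD('d)"
proof -
  define c where "c = (1 - p) / (2 * real CARD('d) - 1) / (6 * real CARD('d))"
  have c: "c > 0" using d p by (simp add: c_def)
  \<comment> \<open>The factor \<open>2\<close> under the root comes from \<open>N - 2 \<ge> N / 2\<close>, which is why \<open>N \<ge> 4\<close> is required.\<close>
  define C where "C = 2 * exp (1/4) * (1 + sqrt (2 / c))"
  have "C > 0" using c by (simp add: C_def add_pos_nonneg)
  moreover have "(\<Sum>h\<in>{h \<in> histories i\<^sub>1 N. (\<Sum>m\<in>{1..N}. h m) = (\<chi> j. of_int (z j))}. history_law p N h)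
      \<le> (C / sqrt (real N)) ^ CARD('d)" (is "?P \<le> _")
    if N: "N \<ge> 4" and z: "\<And>j. \<bar>z j\<bar> \<le> int N" for N z
  proof -
    define K where "K = 2 * N + 1"
    define x :: "real ^ 'd" where "x = (\<chi> j. of_int (z j))"
    let ?H = "histories i\<^sub>1 N" and ?R = "PiE (UNIV :: 'd set) (\<lambda>_. {..<K})"
    have K: "odd K" "K > 0" by (auto simp: K_def)
    have orth: "(\<Sum>r\<in>?R. cis (frequency K r \<bullet> ((\<Sum>m\<in>{1..N}. h m) - x)))
        = (if (\<Sum>m\<in>{1..N}. h m) = x then of_nat K ^ CARD('d) else 0)" if h: "h \<in> ?H" for h
    proof -
      obtain y where y: "(\<Sum>m\<in>{1..N}. h m) = (\<chi> j. of_int (y j))" "\<And>j. \<bar>y j\<bar> \<le> int N"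
        using history_endpoint[OF h] by blast
      have diff: "(\<Sum>m\<in>{1..N}. h m) - x = (\<chi> j. of_int (y j - z j))"
        unfolding y(1) x_def by (simp add: vec_eq_iff)
      have small: "\<bar>y j - z j\<bar> < int K" for j
        using y(2)[of j] z[of j] by (simp add: K_def)
      have "((\<Sum>m\<in>{1..N}. h m) = x) = ((\<lambda>j. y j - z j) = (\<lambda>_. 0))"
        unfolding y(1) x_def by (auto simp: vec_eq_iff fun_eq_iff)
      then show ?thesis
        unfolding diff by (simp only: sum_cis_frequency[OF K(1) small])
    qed
    have cis_frequency: "cis (frequency K r \<bullet> ((\<Sum>m\<in>{1..N}. h m) - x))
        = cis (- (frequency K r \<bullet> x)) * (\<Prod>m\<in>{1..N}. cis (frequency K r \<bullet> h m))" for r h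
      by (simp add: inner_diff_right inner_sum_right cis_sum[symmetric] cis_mult)
    have "of_real (real K ^ CARD('d) * ?P)
        = (\<Sum>h\<in>?H. of_real (history_law p N h) * (if (\<Sum>m\<in>{1..N}. h m) = x then of_nat K ^ CARD('d) else 0))"
      unfolding x_def[symmetric]
      by (simp add: sum_distrib_left sum.inter_filter finite_histories mult_ac if_distrib[of of_real]
          if_distrib[of "\<lambda>u. _ * u"] cong: if_cong)
    also have "\<dots> = (\<Sum>h\<in>?H. of_real (history_law p N h) * (\<Sum>r\<in>?R. cis (frequency K r \<bullet> ((\<Sum>m\<in>{1..N}. h m) - x))))"
      by (intro sum.cong refl) (simp only: orth)
    also have "\<dots> = (\<Sum>h\<in>?H. \<Sum>r\<in>?R. cis (- (frequency K r \<bullet> x))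
        * (history_law p N h * (\<Prod>m\<in>{1..N}. cis (frequency K r \<bullet> h m))))"
      unfolding cis_frequency sum_distrib_left by (simp only: mult_ac)
    also have "\<dots> = (\<Sum>r\<in>?R. cis (- (frequency K r \<bullet> x))
        * (\<Sum>h\<in>?H. history_law p N h * (\<Prod>m\<in>{1..N}. cis (frequency K r \<bullet> h m))))"
      by (subst sum.swap) (simp only: sum_distrib_left)
    finally have "of_real (real K ^ CARD('d) * ?P) = \<dots>" .
    then have "norm (of_real (real K ^ CARD('d) * ?P) :: complex) = norm \<dots>" by (rule arg_cong)
    also have "\<dots> \<le> (\<Sum>r\<in>?R. ((1 + char_bound p (frequency K r)) / 2) ^ (N - 2))"
    proof (rule sum_norm_le)
      fix r
      show "norm (cis (- (frequency K r \<bullet> x))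
        * (\<Sum>h\<in>?H. history_law p N h * (\<Prod>m\<in>{1..N}. cis (frequency K r \<bullet> h m))))
          \<le> ((1 + char_bound p (frequency K r)) / 2) ^ (N - 2)"
        unfolding norm_mult norm_cis mult_1_left
        by (rule norm_char_history_law_le) (use d p N in auto)
    qed
    also have "\<dots> \<le> (2 * exp (1/4) * (1 + real K / sqrt (c * real (N - 2)))) ^ CARD('d)"
      unfolding c_def using d p N K by (intro sum_power_char_bound_le) auto
    also have "\<dots> \<le> (real K * (C / sqrt (real N))) ^ CARD('d)"
    proof (intro power_mono)
      have le: "sqrt (c * real (N - 2)) \<ge> sqrt (c * (real N / 2))"
        using c N by (intro real_sqrt_le_mono mult_left_mono) (auto simp: of_nat_diff)
      have pos: "sqrt (c * (real N / 2)) > 0" using c N by simp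
      have "1 / sqrt (c * real (N - 2)) \<le> 1 / sqrt (c * (real N / 2))"
        by (rule frac_le[OF zero_le_one order_refl pos le])
      also have "\<dots> = sqrt (2 / c) / sqrt (real N)"
        using c N by (simp add: real_sqrt_divide real_sqrt_mult field_simps)
      finally have 1: "real K / sqrt (c * real (N - 2)) \<le> real K * (sqrt (2 / c) / sqrt (real N))"
        using mult_left_mono[of _ _ "real K"] by fastforce
      have "sqrt (real N) \<le> real N"
        using N by (simp add: real_le_lsqrt power2_eq_square)
      also have "\<dots> \<le> real K" by (simp add: K_def)
      finally have 2: "1 \<le> real K / sqrt (real N)" using N by (simp add: field_simps)
      have "1 + real K / sqrt (c * real (N - 2)) \<le> real K / sqrt (real N) + real K * (sqrt (2 / c) / sqrt (real N))"
        using 1 2 by (rule add_mono[rotated])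
      also have "\<dots> = real K * ((1 + sqrt (2 / c)) / sqrt (real N))" by (simp add: algebra_simps add_divide_distrib)
      finally have "2 * exp (1/4) * (1 + real K / sqrt (c * real (N - 2)))
          \<le> 2 * exp (1/4) * (real K * ((1 + sqrt (2 / c)) / sqrt (real N)))"
        by (intro mult_left_mono) auto
      then show "2 * exp (1/4) * (1 + real K / sqrt (c * real (N - 2))) \<le> real K * (C / sqrt (real N))"
        by (simp add: C_def mult_ac)
      show "0 \<le> 2 * exp (1/4) * (1 + real K / sqrt (c * real (N - 2)))"
        using c by (intro mult_nonneg_nonneg add_nonneg_nonneg divide_nonneg_nonneg real_sqrt_ge_zero) auto
    qed
    finally have "real K ^ CARD('d) * ?P \<le> real K ^ CARD('d) * (C / sqrt (real N)) ^ CARD('d)"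
      unfolding norm_of_real power_mult_distrib by linarith
    then show ?thesis using K by (simp add: mult_le_cancel_left_pos)
  qed
  ultimately show ?thesis by blast
qed

section \<open>The law of the elephant random walk\<close>

definition (in merw) follows :: "(nat \<Rightarrow> real ^ 'd) \<Rightarrow> nat \<Rightarrow> 'a set" where
  "follows h n = {\<omega> \<in> space M. \<forall>i\<in>{1..n}. \<sigma> i \<omega> = h i}"

lemma (in merw) step_event [measurable]: "i \<ge> 1 \<Longrightarrow> {\<omega> \<in> space M. \<sigma> i \<omega> = v} \<in> events"
  using random_variable_step[of i] by simp

lemma (in merw) follows_event: "follows h n \<in> events"
  unfolding follows_def by (intro sets.sets_Collect_finite_All step_event) auto

lemma (in merw) follows_in_past:
  "follows h n \<in> sets (vimage_algebra (space M) (\<lambda>\<omega>. \<lambda>i\<in>{1..n}. \<sigma> i \<omega>) (PiM {1..n} (\<lambda>_. borel)))"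
proof -
  have "(\<Pi>\<^sub>E i\<in>{1..n}. {h i}) \<in> sets (PiM {1..n} (\<lambda>_. borel))"
    by (intro sets_PiM_I_finite) auto
  moreover have "follows h n = (\<lambda>\<omega>. \<lambda>i\<in>{1..n}. \<sigma> i \<omega>) -` (\<Pi>\<^sub>E i\<in>{1..n}. {h i}) \<inter> space M"
    by (auto simp: follows_def PiE_def Pi_def)
  ultimately show ?thesis
    by (auto intro: in_vimage_algebra)
qed

lemma (in merw) mem_in_algebra:
  "{\<omega> \<in> space M. mem n \<omega> = k} \<in> sets (vimage_algebra (space M) (mem n) (count_space UNIV))"
proof -
  have "{\<omega> \<in> space M. mem n \<omega> = k} = mem n -` {k} \<inter> space M" by auto
  then show ?thesis by (auto intro: in_vimage_algebra)
qed

lemma (in merw) mem_event: "n \<ge> 1 \<Longrightarrow> {\<omega> \<in> space M. mem n \<omega> = k} \<in> events"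
  using mem_indep_past[of n] mem_in_algebra[of n k] unfolding indep_set_def indep_sets_def
  by (auto split: bool.splits)

lemma (in merw) mem_measurable: "n \<ge> 1 \<Longrightarrow> mem n \<in> measurable M (count_space UNIV)"
  using mem_event[of n] by (simp add: measurable_count_space_eq2_countable vimage_def Int_def conj_commute)

lemma (in merw) prob_mem:
  assumes "n \<ge> 1" "k \<in> {1..n}"
  shows "prob {\<omega> \<in> space M. mem n \<omega> = k} = 1 / real n"
proof -
  have "prob {\<omega> \<in> space M. mem n \<omega> = k} = measure (distr M (count_space UNIV) (mem n)) {k}"
    using mem_measurable[OF assms(1)] by (subst measure_distr) (auto intro!: arg_cong[where f = prob])
  also have "\<dots> = 1 / real n"
    using assms by (simp add: mem_uniform measure_pmf_single)
  finally show ?thesis .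
qed

lemma (in merw) AE_mem:
  assumes "n \<ge> 1"
  shows "AE \<omega> in M. mem n \<omega> \<in> {1..n}"
proof (rule AE_distrD[OF mem_measurable[OF assms]])
  show "AE x in distr M (count_space UNIV) (mem n). x \<in> {1..n}"
    unfolding mem_uniform[OF assms] using assms by (simp add: AE_measure_pmf_iff)
qed

lemma (in merw) prob_follows_mem:
  assumes "n \<ge> 1" "k \<in> {1..n}"
  shows "prob (follows h n \<inter> {\<omega> \<in> space M. mem n \<omega> = k}) = prob (follows h n) / real n"
  using indep_setD[OF mem_indep_past[OF assms(1)] follows_in_past[of h n] mem_in_algebra[of n k]]
    prob_mem[OF assms] by simp

text \<open>
  The hypotheses on the conditional probabilities speak only of conditions of positive probability;
  under a null condition both sides vanish.
\<close>

lemma (in merw) prob_follows_Suc_mem: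
  assumes n: "n \<ge> 1" and k: "k \<in> {1..n}" and v: "h (Suc n) \<in> unit_steps"
  shows "prob {\<omega> \<in> space M. (\<omega> \<in> follows h n \<and> mem n \<omega> = k) \<and> \<sigma> (Suc n) \<omega> = h (Suc n)}
    = step_weight p (h k) (h (Suc n)) * (prob (follows h n) / real n)"
proof -
  let ?Q = "\<lambda>\<omega>. (\<forall>i\<in>{1..n}. \<sigma> i \<omega> = h i) \<and> mem n \<omega> = k"
  have Q: "{\<omega> \<in> space M. ?Q \<omega>} = follows h n \<inter> {\<omega> \<in> space M. mem n \<omega> = k}" by (auto simp: follows_def)
  have E: "{\<omega> \<in> space M. (\<omega> \<in> follows h n \<and> mem n \<omega> = k) \<and> \<sigma> (Suc n) \<omega> = h (Suc n)}
      = {\<omega> \<in> space M. \<sigma> (Suc n) \<omega> = h (Suc n) \<and> ?Q \<omega>}" by (auto simp: follows_def)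
  have Q_event: "{\<omega> \<in> space M. ?Q \<omega>} \<in> events"
    unfolding Q using follows_event mem_event[OF n] by auto
  show ?thesis
  proof (cases "prob {\<omega> \<in> space M. ?Q \<omega>} > 0")
    case True
    have "\<P>(\<omega> in M. \<sigma> (Suc n) \<omega> = h (Suc n) \<bar> ?Q \<omega>) = step_weight p (h k) (h (Suc n))"
    proof (cases "h (Suc n) = h k")
      case eq: True
      show ?thesis unfolding eq using step_repeat[OF n k True] by (simp add: step_weight_def)
    next
      case False
      show ?thesis using step_change[OF n k _ True, of "h (Suc n)"] v False by (simp add: step_weight_def)
    qed
    then show ?thesis
      using True unfolding E cond_prob_def prob_follows_mem[OF n k, symmetric] Q[symmetric]
      by (simp add: field_simps)
  next
    case False
    then have "prob {\<omega> \<in> space M. ?Q \<omega>} = 0" using measure_nonneg[of M "{\<omega> \<in> space M. ?Q \<omega>}"] by linarith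
    moreover have "prob {\<omega> \<in> space M. \<sigma> (Suc n) \<omega> = h (Suc n) \<and> ?Q \<omega>} \<le> prob {\<omega> \<in> space M. ?Q \<omega>}"
      by (intro finite_measure_mono Q_event) auto
    ultimately have "prob {\<omega> \<in> space M. \<sigma> (Suc n) \<omega> = h (Suc n) \<and> ?Q \<omega>} = 0"
      using measure_nonneg[of M "{\<omega> \<in> space M. \<sigma> (Suc n) \<omega> = h (Suc n) \<and> ?Q \<omega>}"] by linarith
    with \<open>prob {\<omega> \<in> space M. ?Q \<omega>} = 0\<close> show ?thesis
      unfolding E prob_follows_mem[OF n k, symmetric] Q[symmetric] by simp
  qed
qed

lemma (in merw) prob_follows_Suc:
  assumes n: "n \<ge> 1" and v: "h (Suc n) \<in> unit_steps"
  shows "prob (follows h (Suc n)) = prob (follows h n) * ((\<Sum>k\<in>{1..n}. step_weight p (h k) (h (Suc n))) / real n)"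
proof -
  have "follows h (Suc n) = {\<omega> \<in> space M. \<omega> \<in> follows h n \<and> \<sigma> (Suc n) \<omega> = h (Suc n)}"
    by (auto simp: follows_def atLeastAtMostSuc_conv)
  also have "prob \<dots> = (\<Sum>k\<in>{1..n}. prob {\<omega> \<in> space M. (\<omega> \<in> follows h n \<and> mem n \<omega> = k) \<and> \<sigma> (Suc n) \<omega> = h (Suc n)})"
  proof (rule prob_sum)
    show "AE \<omega> in M.
        (\<forall>k\<in>{1..n}. (\<omega> \<in> follows h n \<and> mem n \<omega> = k) \<and> \<sigma> (Suc n) \<omega> = h (Suc n)
          \<longrightarrow> \<omega> \<in> follows h n \<and> \<sigma> (Suc n) \<omega> = h (Suc n))
      \<and> (\<omega> \<in> follows h n \<and> \<sigma> (Suc n) \<omega> = h (Suc n)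
          \<longrightarrow> (\<exists>!k. k \<in> {1..n} \<and> (\<omega> \<in> follows h n \<and> mem n \<omega> = k) \<and> \<sigma> (Suc n) \<omega> = h (Suc n)))"
      using AE_mem[OF n] by eventually_elim auto
    have [measurable]: "follows h n \<in> events" by (rule follows_event)
    have [measurable]: "{\<omega> \<in> space M. mem n \<omega> = k} \<in> events" for k by (rule mem_event[OF n])
    have [measurable]: "{\<omega> \<in> space M. \<sigma> (Suc n) \<omega> = h (Suc n)} \<in> events" by (rule step_event) simp
    show "{\<omega> \<in> space M. \<omega> \<in> follows h n \<and> \<sigma> (Suc n) \<omega> = h (Suc n)} \<in> events" by measurable
    show "{\<omega> \<in> space M. (\<omega> \<in> follows h n \<and> mem n \<omega> = k) \<and> \<sigma> (Suc n) \<omega> = h (Suc n)} \<in> events" for k by measurable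
  qed simp
  also have "\<dots> = prob (follows h n) * ((\<Sum>k\<in>{1..n}. step_weight p (h k) (h (Suc n))) / real n)"
    using prob_follows_Suc_mem[where h = h, OF n _ v] by (simp add: sum_distrib_left sum_divide_distrib mult_ac)
  finally show ?thesis .
qed

lemma (in merw) prob_follows:
  assumes "N \<ge> 1" "h 1 = axis i\<^sub>1 1" "\<And>m. m \<in> {1..N} \<Longrightarrow> h m \<in> unit_steps"
  shows "prob (follows h N) = history_law p N h"
  using assms(1,3)
proof (induction N rule: dec_induct)
  case base
  have "follows h 1 = space M" using first_step assms(2) by (auto simp: follows_def)
  then show ?case by (simp add: history_law_def prob_space)
next
  case (step N)
  have eq: "{2..Suc N} = insert (Suc N) {2..N}" using step.hyps by auto
  have "prob (follows h (Suc N)) = history_law p N h * ((\<Sum>k\<in>{1..N}. step_weight p (h k) (h (Suc N))) / real N)"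
    using step by (subst prob_follows_Suc) auto
  also have "\<dots> = history_law p (Suc N) h"
    unfolding history_law_def eq by (simp add: atLeastLessThanSuc_atLeastAtMost mult.commute)
  finally show ?case .
qed

lemma (in merw) prob_follows_history:
  assumes "N \<ge> 1" "h \<in> histories i\<^sub>1 N"
  shows "prob (follows h N) = history_law p N h"
proof (rule prob_follows)
  show "h 1 = axis i\<^sub>1 1"
    using PiE_mem[OF assms(2)[unfolded histories_def], of 1] assms(1) by simp
qed (use assms history_in_unit_steps in auto)

lemma (in merw) follows_unique:
  assumes "h \<in> histories i\<^sub>1 N" "h' \<in> histories i\<^sub>1 N" "\<omega> \<in> follows h N" "\<omega> \<in> follows h' N"
  shows "h = h'"
  using assms(1,2) unfolding histories_def
  by (rule PiE_ext) (use assms(3,4) in \<open>simp add: follows_def\<close>)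

text \<open>
  The probabilities of the listed histories already add up to one, so almost every path of the walk
  has unit steps and starts with the prescribed one.
\<close>

lemma (in merw) AE_follows_history:
  assumes "N \<ge> 1"
  shows "AE \<omega> in M. \<exists>h\<in>histories i\<^sub>1 N. \<omega> \<in> follows h N"
proof -
  have ev: "{\<omega> \<in> space M. \<exists>h\<in>histories i\<^sub>1 N. \<omega> \<in> follows h N} \<in> events"
    using follows_event by (intro sets.sets_Collect_finite_Ex finite_histories) auto
  have "prob {\<omega> \<in> space M. \<exists>h\<in>histories i\<^sub>1 N. \<omega> \<in> follows h N}
      = (\<Sum>h\<in>histories i\<^sub>1 N. prob {\<omega> \<in> space M. \<omega> \<in> follows h N})"
  proof (rule prob_sum[OF finite_histories])
    show "AE \<omega> in M. (\<forall>h\<in>histories i\<^sub>1 N. \<omega> \<in> follows h N \<longrightarrow> (\<exists>h\<in>histories i\<^sub>1 N. \<omega> \<in> follows h N))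
        \<and> ((\<exists>h\<in>histories i\<^sub>1 N. \<omega> \<in> follows h N) \<longrightarrow> (\<exists>!h. h \<in> histories i\<^sub>1 N \<and> \<omega> \<in> follows h N))"
      by (intro AE_I2) (use follows_unique in blast)
    show "{\<omega> \<in> space M. \<omega> \<in> follows h N} \<in> events" for h
      using follows_event[of h N] by (simp add: follows_def)
  qed (rule ev)
  also have "\<dots> = (\<Sum>h\<in>histories i\<^sub>1 N. history_law p N h)"
    using prob_follows_history[OF assms] by (intro sum.cong refl) (simp add: follows_def)
  also have "\<dots> = 1" by (rule sum_history_law[OF assms])
  finally show ?thesis using ev by (simp add: prob_Collect_eq_1)
qed

lemma (in merw) position_eq_sum: "\<omega> \<in> space M \<Longrightarrow> S N \<omega> = (\<Sum>m\<in>{1..N}. \<sigma> m \<omega>)"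
  by (induction N) (auto simp: position_0 position_Suc)

lemma (in merw) position_follows: "\<omega> \<in> follows h N \<Longrightarrow> S N \<omega> = (\<Sum>m\<in>{1..N}. h m)"
  by (simp add: position_eq_sum follows_def)

lemma (in merw) position_measurable [measurable]: "S N \<in> borel_measurable M"
proof -
  have "(\<lambda>\<omega>. \<Sum>m\<in>{1..N}. \<sigma> m \<omega>) \<in> borel_measurable M"
    by (intro borel_measurable_sum random_variable_step) auto
  then show ?thesis by (subst measurable_cong[OF position_eq_sum])
qed

text \<open>
  Almost every path follows exactly one history, so each event about the position is a disjoint
  union of the events of following a history, up to a null set.
\<close>

lemma (in merw) prob_position:
  assumes N: "N \<ge> 1" and P: "{\<omega> \<in> space M. P (S N \<omega>)} \<in> events"
  shows "prob {\<omega> \<in> space M. P (S N \<omega>)} = (\<Sum>h\<in>{h \<in> histories i\<^sub>1 N. P (\<Sum>m\<in>{1..N}. h m)}. history_law p N h)"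
proof -
  let ?H = "{h \<in> histories i\<^sub>1 N. P (\<Sum>m\<in>{1..N}. h m)}"
  have "prob {\<omega> \<in> space M. P (S N \<omega>)} = (\<Sum>h\<in>?H. prob {\<omega> \<in> space M. \<omega> \<in> follows h N})"
  proof (rule prob_sum)
    show "AE \<omega> in M. (\<forall>h\<in>?H. \<omega> \<in> follows h N \<longrightarrow> P (S N \<omega>))
        \<and> (P (S N \<omega>) \<longrightarrow> (\<exists>!h. h \<in> ?H \<and> \<omega> \<in> follows h N))"
      using AE_follows_history[OF N]
    proof eventually_elim
      case (elim \<omega>)
      then show ?case using follows_unique position_follows by (metis (mono_tags, lifting) mem_Collect_eq)
    qed
    show "{\<omega> \<in> space M. \<omega> \<in> follows h N} \<in> events" for h
      using follows_event[of h N] by (simp add: follows_def)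
  qed (simp_all add: P finite_histories)
  also have "\<dots> = (\<Sum>h\<in>?H. history_law p N h)"
    using prob_follows_history[OF N] by (intro sum.cong refl) (simp add: follows_def)
  finally show ?thesis .
qed

section \<open>Escape from the origin\<close>

text \<open>
  A ball of radius \<open>R \<ge> 1\<close> contains at most \<open>(3 R)\<^sup>d\<close> lattice points, and the local bound applies to
  each of them.
\<close>

lemma (in merw) prob_ball_le:
  assumes d: "CARD('d) \<ge> 3" and p: "0 \<le> p" "p < 1"
  shows "\<exists>C>0. \<forall>N\<ge>4. \<forall>R. 1 \<le> R \<longrightarrow> R \<le> real N \<longrightarrow>
    prob {\<omega> \<in> space M. norm (S N \<omega>) \<le> R} \<le> (C * R / sqrt (real N)) ^ CARD('d)"
proof -
  from endpoint_probability_le[OF d p, of i\<^sub>1] obtain C where C: "C > 0"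
    and bound: "\<And>N z. N \<ge> 4 \<Longrightarrow> (\<And>j. \<bar>z j\<bar> \<le> int N) \<Longrightarrow>
      (\<Sum>h\<in>{h \<in> histories i\<^sub>1 N. (\<Sum>m\<in>{1..N}. h m) = (\<chi> j. of_int (z j))}. history_law p N h)
        \<le> (C / sqrt (real N)) ^ CARD('d)"
    by blast
  have "prob {\<omega> \<in> space M. norm (S N \<omega>) \<le> R} \<le> (3 * C * R / sqrt (real N)) ^ CARD('d)"
    if N: "N \<ge> 4" and R: "1 \<le> R" "R \<le> real N" for N R
  proof -
    let ?H = "histories i\<^sub>1 N"
    let ?X = "\<lambda>z :: 'd \<Rightarrow> int. {h \<in> ?H. (\<Sum>m\<in>{1..N}. h m) = (\<chi> j. of_int (z j))}"
    define Z where "Z = (PiE UNIV (\<lambda>_. {-\<lfloor>R\<rfloor>..\<lfloor>R\<rfloor>}) :: ('d \<Rightarrow> int) set)"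
    have finZ: "finite Z" unfolding Z_def by (intro finite_PiE) auto
    have floor: "0 \<le> \<lfloor>R\<rfloor>" "\<lfloor>R\<rfloor> \<le> int N" using R by (auto simp: floor_le_iff)
    have cover: "{h \<in> ?H. norm (\<Sum>m\<in>{1..N}. h m) \<le> R} \<subseteq> (\<Union>z\<in>Z. ?X z)"
    proof
      fix h assume h: "h \<in> {h \<in> ?H. norm (\<Sum>m\<in>{1..N}. h m) \<le> R}"
      then obtain y where y: "(\<Sum>m\<in>{1..N}. h m) = (\<chi> j. of_int (y j))"
        using history_endpoint[of h i\<^sub>1 N] by blast
      have "y j \<in> {-\<lfloor>R\<rfloor>..\<lfloor>R\<rfloor>}" for j
      proof -
        have "norm (\<chi> j. real_of_int (y j)) \<le> R" using h unfolding y[symmetric] by simp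
        then have "\<bar>real_of_int (y j)\<bar> \<le> R"
          using component_le_norm_cart[of "\<chi> j. real_of_int (y j)" j] by simp
        then have "real_of_int \<bar>y j\<bar> \<le> R" by simp
        then have "\<bar>y j\<bar> \<le> \<lfloor>R\<rfloor>" by (simp only: le_floor_iff)
        then show ?thesis by auto
      qed
      then show "h \<in> (\<Union>z\<in>Z. ?X z)" using h y by (auto simp: Z_def)
    qed
    have "prob {\<omega> \<in> space M. norm (S N \<omega>) \<le> R}
        = (\<Sum>h\<in>{h \<in> ?H. norm (\<Sum>m\<in>{1..N}. h m) \<le> R}. history_law p N h)"
      using N by (intro prob_position) auto
    also have "\<dots> \<le> (\<Sum>h\<in>(\<Union>z\<in>Z. ?X z). history_law p N h)"
      using p by (intro sum_mono2 cover finite_UN_I finZ history_law_nonneg) (auto simp: finite_histories)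
    also have "\<dots> = (\<Sum>z\<in>Z. \<Sum>h\<in>?X z. history_law p N h)"
      by (intro sum.UNION_disjoint finZ ballI impI) (auto simp: finite_histories vec_eq_iff)
    also have "\<dots> \<le> (\<Sum>z\<in>Z. (C / sqrt (real N)) ^ CARD('d))"
    proof (intro sum_mono bound N)
      fix z j assume "z \<in> Z"
      then have "z j \<in> {-\<lfloor>R\<rfloor>..\<lfloor>R\<rfloor>}" by (auto simp: Z_def)
      with floor(2) show "\<bar>z j\<bar> \<le> int N" by auto
    qed
    also have "\<dots> = (of_int (2 * \<lfloor>R\<rfloor> + 1)) ^ CARD('d) * (C / sqrt (real N)) ^ CARD('d)"
      using floor by (simp add: Z_def card_PiE algebra_simps)
    also have "\<dots> \<le> (3 * R) ^ CARD('d) * (C / sqrt (real N)) ^ CARD('d)"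
    proof (intro mult_right_mono power_mono)
      have "2 * real_of_int \<lfloor>R\<rfloor> + 1 \<le> 3 * R" using R(1) of_int_floor_le[of R] by linarith
      then show "real_of_int (2 * \<lfloor>R\<rfloor> + 1) \<le> 3 * R" by simp
    qed (use floor C in auto)
    also have "\<dots> = (3 * R * (C / sqrt (real N))) ^ CARD('d)"
      by (rule power_mult_distrib[symmetric])
    also have "3 * R * (C / sqrt (real N)) = 3 * C * R / sqrt (real N)" by simp
    finally show ?thesis .
  qed
  with C show ?thesis by (intro exI[of _ "3 * C"]) auto
qed

text \<open>
  With \<open>p = 1\<close> every step repeats the first one; the local bound fails in this degenerate case.
\<close>

lemma (in merw) AE_position_full_memory:
  assumes "p = 1" "N \<ge> 1"
  shows "AE \<omega> in M. S N \<omega> = real N *\<^sub>R axis i\<^sub>1 1"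
proof -
  let ?h = "\<lambda>_::nat. axis i\<^sub>1 1 :: real ^ 'd"
  have "prob (follows ?h N) = history_law p N ?h"
    using assms by (intro prob_follows) (auto simp: axis_in_unit_steps)
  also have "\<dots> = 1"
    unfolding history_law_def by (intro prod.neutral) (auto simp: step_weight_def assms(1) of_nat_diff)
  finally have "AE \<omega> in M. \<omega> \<in> follows ?h N"
    using follows_event by (simp add: prob_eq_1)
  then show ?thesis
    by eventually_elim (simp add: position_follows scaleR_conv_of_real sum_constant_scaleR)
qed

text \<open>
  For \<open>p < 1\<close> this is the bound for balls, whose range \<open>{1..N}\<close> contains the radius \<open>N powr \<nu>\<close>; for
  \<open>p = 1\<close> the walk is at distance \<open>N > N powr \<nu>\<close> from the origin.
\<close>

lemma (in merw) prob_near_origin_le: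
  assumes d: "CARD('d) \<ge> 3" and p: "0 \<le> p" "p \<le> 1" and \<nu>: "0 < \<nu>" "\<nu> < 1 / 2"
  shows "\<exists>C. \<forall>N\<ge>4. prob {\<omega> \<in> space M. norm (S N \<omega>) \<le> real N powr \<nu>}
    \<le> C * real N powr ((\<nu> - 1 / 2) * real CARD('d))"
proof (cases "p = 1")
  case True
  have "prob {\<omega> \<in> space M. norm (S N \<omega>) \<le> real N powr \<nu>} = 0" if N: "N \<ge> 4" for N
  proof -
    have "real N powr \<nu> < real N powr 1" using N \<nu> by (intro powr_less_mono) auto
    then have "AE \<omega> in M. \<not> norm (S N \<omega>) \<le> real N powr \<nu>"
      using AE_position_full_memory[OF True, of N] N by (auto elim!: eventually_mono)
    then show ?thesis by (subst prob_Collect_eq_0) auto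
  qed
  then show ?thesis by (intro exI[of _ 0]) auto
next
  case False
  then obtain C where C: "C > 0" and bound: "\<And>N R. N \<ge> 4 \<Longrightarrow> 1 \<le> R \<Longrightarrow> R \<le> real N \<Longrightarrow>
      prob {\<omega> \<in> space M. norm (S N \<omega>) \<le> R} \<le> (C * R / sqrt (real N)) ^ CARD('d)"
    using prob_ball_le[OF d p(1)] p(2) by force
  have "prob {\<omega> \<in> space M. norm (S N \<omega>) \<le> real N powr \<nu>}
      \<le> C ^ CARD('d) * real N powr ((\<nu> - 1 / 2) * real CARD('d))" if N: "N \<ge> 4" for N
  proof -
    have "real N powr \<nu> \<le> real N powr 1" using N \<nu> by (intro powr_mono) auto
    then have "prob {\<omega> \<in> space M. norm (S N \<omega>) \<le> real N powr \<nu>}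
        \<le> (C * real N powr \<nu> / sqrt (real N)) ^ CARD('d)"
      using N \<nu> by (intro bound ge_one_powr_ge_zero) auto
    also have "C * real N powr \<nu> / sqrt (real N) = C * real N powr (\<nu> - 1 / 2)"
      using N by (simp add: powr_diff powr_half_sqrt)
    also have "(C * real N powr (\<nu> - 1 / 2)) ^ CARD('d) = C ^ CARD('d) * real N powr ((\<nu> - 1 / 2) * real CARD('d))"
      using N by (simp add: power_mult_distrib powr_power mult.commute)
    finally show ?thesis .
  qed
  then show ?thesis by blast
qed

lemma (in merw) summable_prob_near_origin:
  assumes d: "CARD('d) \<ge> 3" and p: "0 \<le> p" "p \<le> 1" and \<nu>: "0 < \<nu>" "\<nu> < 1 / 2 - 1 / real CARD('d)"
  shows "summable (\<lambda>N. prob {\<omega> \<in> space M. norm (S N \<omega>) \<le> real N powr \<nu>})"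
proof -
  have "\<nu> < 1 / 2" using \<nu>(2) by (rule less_le_trans) simp
  then obtain C where C: "\<And>N. N \<ge> 4 \<Longrightarrow> prob {\<omega> \<in> space M. norm (S N \<omega>) \<le> real N powr \<nu>}
      \<le> C * real N powr ((\<nu> - 1 / 2) * real CARD('d))"
    using prob_near_origin_le[OF d p \<nu>(1)] by blast
  have "(\<nu> - 1 / 2) * real CARD('d) < - (1 / real CARD('d)) * real CARD('d)"
    using \<nu>(2) d by (intro mult_strict_right_mono) auto
  also have "\<dots> = -1" using d by simp
  finally have "summable (\<lambda>N. C * real N powr ((\<nu> - 1 / 2) * real CARD('d)))"
    by (intro summable_mult) (simp add: summable_real_powr_iff)
  then show ?thesis
    by (rule summable_comparison_test') (use C in auto)
qed

lemma (in merw) expected_visits_finite: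
  assumes "summable (\<lambda>N. prob {\<omega> \<in> space M. norm (S N \<omega>) \<le> real N powr \<nu>})"
  shows "(\<integral>\<^sup>+ \<omega>. (\<Sum>n. indicator {\<omega>. norm (S (Suc n) \<omega>) \<le> real (Suc n) powr \<nu>} \<omega>) \<partial>M) < \<infinity>"
proof -
  let ?A = "\<lambda>N. {\<omega> \<in> space M. norm (S N \<omega>) \<le> real N powr \<nu>}"
  have "(\<integral>\<^sup>+ \<omega>. (\<Sum>n. indicator {\<omega>. norm (S (Suc n) \<omega>) \<le> real (Suc n) powr \<nu>} \<omega>) \<partial>M)
      = (\<integral>\<^sup>+ \<omega>. (\<Sum>n. indicator (?A (Suc n)) \<omega>) \<partial>M)"
    by (intro nn_integral_cong suminf_cong) (simp add: indicator_def)
  also have "\<dots> = (\<Sum>n. \<integral>\<^sup>+ \<omega>. indicator (?A (Suc n)) \<omega> \<partial>M)"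
    by (intro nn_integral_suminf) measurable
  also have "\<dots> = (\<Sum>n. ennreal (prob (?A (Suc n))))"
    by (intro suminf_cong) (simp add: emeasure_eq_measure)
  also have "\<dots> = ennreal (\<Sum>n. prob (?A (Suc n)))"
  proof (rule suminf_ennreal2)
    show "summable (\<lambda>n. prob (?A (Suc n)))"
      using assms by (subst summable_Suc_iff)
  qed simp
  finally show ?thesis by (simp add: less_top)
qed

lemma (in merw) AE_eventually_far:
  assumes "summable (\<lambda>N. prob {\<omega> \<in> space M. norm (S N \<omega>) \<le> real N powr \<nu>})"
  shows "AE \<omega> in M. \<forall>\<^sub>F n in sequentially. norm (S n \<omega>) > real n powr \<nu>"
proof -
  have "AE \<omega> in M. \<forall>\<^sub>F n in sequentially. \<omega> \<in> space M - {\<omega> \<in> space M. norm (S n \<omega>) \<le> real n powr \<nu>}"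
    by (rule borel_cantelli_AE1) (use assms in \<open>auto simp: emeasure_eq_measure\<close>)
  then show ?thesis
    by eventually_elim (auto elim!: eventually_mono)
qed

text \<open>
  A path that eventually leaves every ball visits each point only finitely often.
\<close>

lemma (in merw) transient_if_eventually_far:
  assumes \<nu>: "\<nu> > 0" and far: "AE \<omega> in M. \<forall>\<^sub>F n in sequentially. norm (S n \<omega>) > real n powr \<nu>"
  shows "transient_walk M S"
  unfolding transient_walk_def
proof
  fix x :: "real ^ 'd"
  have "filterlim (\<lambda>n. real n powr \<nu>) at_top sequentially"
    using \<nu> by real_asymp
  then have large: "\<forall>\<^sub>F n in sequentially. norm x < real n powr \<nu>"
    by (simp add: filterlim_at_top_dense)
  have finite_iff: "finite {n. S n \<omega> = x} \<longleftrightarrow> (\<exists>m. \<forall>n. n \<ge> m \<longrightarrow> S n \<omega> \<noteq> x)" for \<omega>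
    by (auto simp: finite_nat_set_iff_bounded not_le[symmetric])
  have "AE \<omega> in M. finite {n. S n \<omega> = x}"
    using far
  proof eventually_elim
    case (elim \<omega>)
    with large have "\<forall>\<^sub>F n in sequentially. S n \<omega> \<noteq> x"
      by eventually_elim auto
    then show ?case by (simp add: finite_iff eventually_sequentially)
  qed
  moreover have "{\<omega> \<in> space M. finite {n. S n \<omega> = x}} \<in> events"
    unfolding finite_iff by measurable
  ultimately show "\<P>(\<omega> in M. finite {n. S n \<omega> = x}) = 1"
    by (simp add: prob_Collect_eq_1)
qed

theorem theorem1p1:
  fixes M :: "'a measure" and p :: real and i\<^sub>1 :: "'d :: finite"
    and mem :: "nat \<Rightarrow> 'a \<Rightarrow> nat" and \<sigma> S :: "nat \<Rightarrow> 'a \<Rightarrow> real ^ 'd"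
  assumes "CARD('d) \<ge> 3" and "p \<in> {0..1}" and "merw M p i\<^sub>1 mem \<sigma> S"
  shows "transient_walk M S \<and>
    (\<forall>\<nu>\<in>{0<..<1 / 2 - 1 / real CARD('d)}.
       (\<integral>\<^sup>+ \<omega>. (\<Sum>n. indicator {\<omega>. norm (S (Suc n) \<omega>) \<le> real (Suc n) powr \<nu>} \<omega>) \<partial>M) < \<infinity> \<and>
       (AE \<omega> in M. \<forall>\<^sub>F n in sequentially. norm (S n \<omega>) > real n powr \<nu>))"
proof -
  interpret merw M p i\<^sub>1 mem \<sigma> S by (rule assms(3))
  have summable: "summable (\<lambda>N. prob {\<omega> \<in> space M. norm (S N \<omega>) \<le> real N powr \<nu>})"
    if "\<nu> \<in> {0<..<1 / 2 - 1 / real CARD('d)}" for \<nu>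
    using that assms(1,2) by (intro summable_prob_near_origin) auto
  \<comment> \<open>Any admissible exponent would do for transience; the midpoint of their range is one.\<close>
  define \<nu>\<^sub>0 where "\<nu>\<^sub>0 = (1 / 2 - 1 / real CARD('d)) / 2"
  have \<nu>\<^sub>0: "\<nu>\<^sub>0 \<in> {0<..<1 / 2 - 1 / real CARD('d)}"
    using assms(1) by (simp add: \<nu>\<^sub>0_def field_simps)
  then have "transient_walk M S"
    by (intro transient_if_eventually_far[of \<nu>\<^sub>0] AE_eventually_far summable) auto
  then show ?thesis
    using expected_visits_finite[OF summable] AE_eventually_far[OF summable] by blast
qed

end
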